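(* Let $1<p_1,p_2,p<\infty$ with $\frac1p=\frac1{p_1}+\frac1{p_2}$, and let $\frac12<a<1$. Then there exists a constant $C>0$ (independent of $\Omega,f_1,f_2$) such that for every measurable $\Omega:\mathbb{S}^1\to\mathbb{C}$ satisfying $\|\Omega\|_{\mathcal{K}_a}<\infty$, and for all $f_1\in L^{p_1}(\mathbb{R})$, $f_2\in L^{p_2}(\mathbb{R})$, $$\|M_\Omega(f_1,f_2)\|_{L^p(\mathbb{R})}\le C\,\|\Omega\|_{\mathcal{K}_a}\,\|f_1\|_{L^{p_1}(\mathbb{R})}\,\|f_2\|_{L^{p_2}(\mathbb{R})}.$$
   Context: $\mathbb{S}^1$ is the unit circle in $\mathbb{R}^2$ and $\sigma$ is arc-length measure on it. For $0<a<1$ and measurable $\Omega$ on $\mathbb{S}^1$, $$\|\Omega\|_{\mathcal{K}_a}:=\sup_{\xi\in\mathbb{S}^1}\int_{\mathbb{S}^1}\frac{|\Omega(\theta)|}{|\theta\cdot\xi|^a}\,d\sigma(\theta).$$ The bilinear rough maximal operator is $$M_\Omega(f_1,f_2)(x)=\sup_{R>0}\frac1{R^2}\int_{|(y_1,y_2)|\le R}\left|\Omega\left(\frac{(y_1,y_2)}{|(y_1,y_2)|}\right)\right|\,|f_1(x-y_1)f_2(x-y_2)|\,dy_1\,dy_2,\qquad x\in\mathbb{R}.$$ No mean-zero condition on $\Omega$ is assumed. *)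

theory Defs
  imports "HOL-Analysis.Analysis"
begin

definition ennreal_powr :: "ennreal \<Rightarrow> real \<Rightarrow> ennreal" where
  "ennreal_powr x q = (if x = \<infinity> then \<infinity> else ennreal (enn2real x powr q))"
  \<comment> \<open>only meant for \<open>q > 0\<close>\<close>

text \<open>
  The \<open>L\<^sup>q(\<real>)\<close> norm, \<open>0 < q < \<infinity>\<close>, of the function with modulus \<open>g\<close>.  A Lebesgue
  non-measurable modulus gets norm \<open>\<infinity>\<close>, so a finite bound on the norm includes the
  measurability of \<open>g\<close> (\<open>nn_integral\<close> itself is only a lower integral).
\<close>

definition Lp_norm :: "real \<Rightarrow> (real \<Rightarrow> ennreal) \<Rightarrow> ennreal" where
  "Lp_norm q g =
     (if g \<in> borel_measurable lebesgue
      then ennreal_powr (\<integral>\<^sup>+ x. ennreal_powr (g x) q \<partial>lebesgue) (1 / q)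
      else \<infinity>)"

definition Lp_space :: "real \<Rightarrow> (real \<Rightarrow> complex) set" where
  "Lp_space q = {f \<in> borel_measurable lebesgue. Lp_norm q (\<lambda>x. ennreal (cmod (f x))) < \<infinity>}"

text \<open>
  Arc length on the unit circle of \<open>\<real> \<times> \<real>\<close>, completed, so that measurability with
  respect to \<open>arc_length\<close> is Lebesgue (not only Borel) measurability on the circle.
\<close>

definition arc_length :: "(real \<times> real) measure" where
  "arc_length =
     completion (distr (restrict_space lborel {0..<2 * pi}) (restrict_space borel (sphere 0 1))
       (\<lambda>t. (cos t, sin t)))"

lemma arc_length_param_measurable:
  "(\<lambda>t. (cos t, sin t)) \<in>
     restrict_space lborel {0..<2 * pi} \<rightarrow>\<^sub>M restrict_space borel (sphere (0 :: real \<times> real) 1)"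
proof (rule measurable_restrict_space2)
  show "(\<lambda>t. (cos t, sin t)) \<in> space (restrict_space lborel {0..<2 * pi}) \<rightarrow> sphere (0 :: real \<times> real) 1"
    by (auto simp: norm_Pair)
  have "(\<lambda>t::real. (cos t, sin t)) \<in> borel_measurable borel"
    by (intro borel_measurable_continuous_onI continuous_intros)
  then show "(\<lambda>t. (cos t, sin t)) \<in> borel_measurable (restrict_space lborel {0..<2 * pi})"
    by (intro measurable_restrict_space1) simp
qed

lemma space_arc_length: "space arc_length = sphere 0 1"
  by (simp add: arc_length_def space_restrict_space)

lemma emeasure_arc_length_circle: "emeasure arc_length (sphere 0 1) = ennreal (2 * pi)"
proof -
  let ?M = "restrict_space lborel {0..<2 * pi}"
  let ?N = "restrict_space borel (sphere (0 :: real \<times> real) 1)"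
  let ?g = "\<lambda>t::real. (cos t, sin t)"
  have top: "sphere 0 1 \<in> sets ?N"
    using sets.top[of ?N] by (simp add: space_restrict_space)
  have "?g -` sphere 0 1 \<inter> space ?M = {0..<2 * pi}"
    by (auto simp: space_restrict_space norm_Pair)
  then have "emeasure (distr ?M ?N ?g) (sphere 0 1) = emeasure ?M {0..<2 * pi}"
    using emeasure_distr[OF arc_length_param_measurable top] by simp
  also have "\<dots> = ennreal (2 * pi)"
    by (simp add: emeasure_restrict_space)
  finally show ?thesis
    using top by (simp add: arc_length_def)
qed

text \<open>
  The quotient is taken in \<open>[0, \<infinity>]\<close>, where \<open>c / 0 = \<infinity>\<close> for \<open>c > 0\<close> and \<open>0 / 0 = 0\<close>;
  for each \<open>\<xi>\<close> the denominator vanishes at two points of the circle only.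
\<close>

definition K_norm :: "real \<Rightarrow> (real \<times> real \<Rightarrow> complex) \<Rightarrow> ennreal" where
  "K_norm a \<Omega> =
     (SUP \<xi>\<in>sphere 0 1.
        \<integral>\<^sup>+ \<theta>. ennreal (cmod (\<Omega> \<theta>)) / ennreal (\<bar>\<theta> \<bullet> \<xi>\<bar> powr a) \<partial>arc_length)"

definition rough_maximal ::
    "(real \<times> real \<Rightarrow> complex) \<Rightarrow> (real \<Rightarrow> complex) \<Rightarrow> (real \<Rightarrow> complex) \<Rightarrow> real \<Rightarrow> ennreal" where
  "rough_maximal \<Omega> f\<^sub>1 f\<^sub>2 x =
     (SUP R\<in>{0<..}.
        ennreal (1 / R\<^sup>2) *
        (\<integral>\<^sup>+ y\<in>cball 0 R.
           ennreal (cmod (\<Omega> (y /\<^sub>R norm y)) * cmod (f\<^sub>1 (x - fst y) * f\<^sub>2 (x - snd y))) \<partial>lebesgue))"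

end

theory Submission
  imports Defs
begin

text \<open>
  The maximal function is dominated pointwise by a product of one-dimensional Hardy--Littlewood
  maximal functions.  In polar coordinates the average defining \<open>M\<^sub>\<Omega>\<close> is at most an integral over directions
  \<open>\<theta>\<close>, with weight \<open>\<bar>\<Omega>(\<theta>)\<bar>\<close>, of the averages of \<open>\<bar>f\<^sub>1(x - r cos \<theta>) f\<^sub>2(x - r sin \<theta>)\<bar>\<close> over \<open>0 < r \<le> R\<close>.
  Put \<open>u = p / p\<^sub>1\<close> and \<open>v = p / p\<^sub>2\<close>, so that \<open>u + v = 1\<close>.  Hoelder's inequality in \<open>r\<close> separates the
  two functions.  Each of the two resulting averages runs along one coordinate of the ray, and after rescaling
  it is an average over an interval with one end at \<open>x\<close>, so it is bounded independently of \<open>\<theta>\<close>.  Hence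
  \<open>M\<^sub>\<Omega>(f\<^sub>1, f\<^sub>2)(x) \<le> 2 \<parallel>\<Omega>\<parallel>\<^sub>1 M(\<bar>f\<^sub>1\<bar>\<^bsup>1/u\<^esup>)(x)\<^bsup>u\<^esup> M(\<bar>f\<^sub>2\<bar>\<^bsup>1/v\<^esup>)(x)\<^bsup>v\<^esup>\<close>
  (\<open>rough_average_le\<close>), and \<open>\<parallel>\<Omega>\<parallel>\<^sub>1\<close> is at most the \<open>\<K>\<^sub>a\<close> norm because \<open>\<bar>\<theta> \<bullet> \<xi>\<bar> \<le> 1\<close>
  (\<open>nn_integral_arc_length_le_K_norm\<close>).

  Hoelder's inequality in \<open>x\<close> with the same weights (\<open>Hoelder_nn_integral\<close>) reduces the \<open>L\<^sup>p\<close> bound to the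
  boundedness of \<open>M\<close> on \<open>L\<^sup>p\<close>, \<open>p > 1\<close> (\<open>hl_maximal_Lp\<close>, from Vitali's covering lemma
  and interpolation), applied to \<open>\<bar>f\<^sub>1\<bar>\<^bsup>1/u\<^esup>\<close> and \<open>\<bar>f\<^sub>2\<bar>\<^bsup>1/v\<^esup>\<close>,
  whose \<open>p\<close>-th powers are \<open>\<bar>f\<^sub>1\<bar>\<close> to the power \<open>p\<^sub>1\<close> and \<open>\<bar>f\<^sub>2\<bar>\<close> to the power \<open>p\<^sub>2\<close>.

  All estimates are made in \<open>[0, \<infinity>]\<close> for Borel functions.  Replacing \<open>\<Omega>\<close>, \<open>f\<^sub>1\<close> and \<open>f\<^sub>2\<close> by Borel
  representatives leaves the maximal function unchanged at every point (\<open>rough_maximal_eq_borel\<close>),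
  since the cone over a null set of the circle is a null set of the plane; this also gives the
  measurability that the norm on the left-hand side demands.
\<close>

section \<open>Powers in \<open>[0, \<infinity>]\<close> and Hoelder's inequality\<close>

lemma ennreal_powr_0 [simp]: "ennreal_powr 0 q = 0"
  by (simp add: ennreal_powr_def)

lemma ennreal_powr_top [simp]: "ennreal_powr top q = top"
  by (simp add: ennreal_powr_def)

lemma ennreal_powr_ennreal [simp]: "0 \<le> r \<Longrightarrow> ennreal_powr (ennreal r) q = ennreal (r powr q)"
  by (simp add: ennreal_powr_def)

lemma ennreal_powr_one [simp]: "ennreal_powr x 1 = x"
  by (cases x) auto

lemma ennreal_powr_mono:
  assumes "x \<le> y" "0 < q"
  shows "ennreal_powr x q \<le> ennreal_powr y q"
  using assms by (cases x; cases y) (auto intro!: ennreal_leI powr_mono2 simp: top_unique)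

lemma ennreal_powr_mult:
  "ennreal_powr (x * y) q = ennreal_powr x q * ennreal_powr y q"
proof (cases "x = 0 \<or> y = 0")
  case False
  then show ?thesis
    by (cases x; cases y)
       (auto simp: ennreal_mult[symmetric] powr_mult ennreal_mult_top ennreal_top_mult)
qed auto

lemma ennreal_powr_powr:
  "ennreal_powr (ennreal_powr x q) r = ennreal_powr x (q * r)"
  by (cases x) (auto simp: powr_powr)

lemma ennreal_powr_eq_0_iff [simp]: "ennreal_powr x q = 0 \<longleftrightarrow> x = 0"
  by (cases x) auto

lemma ennreal_powr_eq_top_iff [simp]: "ennreal_powr x q = top \<longleftrightarrow> x = top"
  by (cases x) auto

lemma ennreal_powr_add:
  "ennreal_powr x (q + r) = ennreal_powr x q * ennreal_powr x r"
  by (cases x) (auto simp: powr_add ennreal_mult)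

lemma borel_measurable_ennreal_powr [measurable (raw)]:
  assumes [measurable]: "f \<in> borel_measurable M"
  shows "(\<lambda>x. ennreal_powr (f x) q) \<in> borel_measurable M"
  unfolding ennreal_powr_def by measurable

text \<open>
  The weighted arithmetic-geometric mean inequality.  Writing the two factors as powers with
  weights \<open>u + v = 1\<close>, instead of using conjugate exponents, is the form in which both
  applications of Hoelder's inequality below arise.
\<close>

lemma Young_ennreal:
  fixes x y :: ennreal
  assumes uv: "0 < u" "0 < v" "u + v = 1"
  shows "ennreal_powr x u * ennreal_powr y v \<le> ennreal u * x + ennreal v * y"
proof (cases "x = 0 \<or> y = 0 \<or> x = top \<or> y = top")
  case True
  then show ?thesis using uv by (auto simp: ennreal_mult_top)
next
  case False
  then obtain a b where ab: "x = ennreal a" "a > 0" "y = ennreal b" "b > 0"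
    by (cases x; cases y) (auto simp: less_le)
  then show ?thesis
    using Youngs_inequality_0[of u v a b] uv
    by (simp add: ennreal_mult[symmetric] ennreal_plus[symmetric] del: ennreal_plus)
qed

text \<open>
  When both integrals are positive and finite, Young's inequality is applied to the two functions
  divided by their integrals and then integrated; the remaining cases are degenerate.
\<close>

lemma Hoelder_nn_integral:
  fixes f g :: "'a \<Rightarrow> ennreal"
  assumes [measurable]: "f \<in> borel_measurable M" "g \<in> borel_measurable M"
    and uv: "0 < u" "0 < v" "u + v = 1"
  shows "(\<integral>\<^sup>+ x. ennreal_powr (f x) u * ennreal_powr (g x) v \<partial>M)
     \<le> ennreal_powr (\<integral>\<^sup>+ x. f x \<partial>M) u * ennreal_powr (\<integral>\<^sup>+ x. g x \<partial>M) v"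
proof -
  define A B where "A = (\<integral>\<^sup>+ x. f x \<partial>M)" and "B = (\<integral>\<^sup>+ x. g x \<partial>M)"
  consider "A = 0 \<or> B = 0" | "A \<noteq> 0" "B \<noteq> 0" "A = top \<or> B = top"
    | "A \<noteq> 0" "B \<noteq> 0" "A \<noteq> top" "B \<noteq> top" by blast
  then show ?thesis
  proof cases
    case 1
    then have "(AE x in M. f x = 0) \<or> (AE x in M. g x = 0)"
      by (simp add: A_def B_def nn_integral_0_iff_AE)
    then have "AE x in M. ennreal_powr (f x) u * ennreal_powr (g x) v = 0" by auto
    then have "(\<integral>\<^sup>+ x. ennreal_powr (f x) u * ennreal_powr (g x) v \<partial>M) = 0"
      by (subst nn_integral_0_iff_AE) measurable
    then show ?thesis by (simp only: zero_le)
  next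
    case 2
    then have "ennreal_powr A u * ennreal_powr B v = top"
      by (auto simp: ennreal_mult_eq_top_iff)
    then show ?thesis by (simp add: A_def B_def)
  next
    case 3
    then obtain \<alpha> \<beta> where \<alpha>: "A = ennreal \<alpha>" "\<alpha> > 0" and \<beta>: "B = ennreal \<beta>" "\<beta> > 0"
      by (cases A; cases B) (auto simp: less_le)
    define c where "c = ennreal (\<alpha> powr u * \<beta> powr v)"
    have cAB: "c = ennreal_powr A u * ennreal_powr B v"
      using \<alpha> \<beta> by (simp add: c_def ennreal_mult)
    have pt: "ennreal_powr (f x) u * ennreal_powr (g x) v
        \<le> c * (ennreal (u / \<alpha>) * f x + ennreal (v / \<beta>) * g x)" for x
    proof -
      \<comment> \<open>The factor that normalisation takes out of a power; \<open>t\<close> will be one of the two integrals.\<close>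
      have sc: "ennreal_powr y r = ennreal (t powr r) * ennreal_powr (ennreal (1 / t) * y) r"
        if "t > 0" for y r t
      proof -
        have "ennreal (t powr r) * ennreal ((1 / t) powr r) = 1"
          using that by (simp add: ennreal_mult[symmetric] powr_mult[symmetric])
        then show ?thesis
          using that by (simp add: ennreal_powr_mult mult.assoc[symmetric])
      qed
      have "ennreal_powr (f x) u * ennreal_powr (g x) v
          = c * (ennreal_powr (ennreal (1 / \<alpha>) * f x) u * ennreal_powr (ennreal (1 / \<beta>) * g x) v)"
        using sc[of \<alpha> "f x" u] sc[of \<beta> "g x" v] \<alpha> \<beta> by (simp add: c_def ennreal_mult ac_simps)
      also have "\<dots> \<le> c * (ennreal u * (ennreal (1 / \<alpha>) * f x) + ennreal v * (ennreal (1 / \<beta>) * g x))"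
        by (intro mult_left_mono Young_ennreal uv) auto
      also have "\<dots> = c * (ennreal (u / \<alpha>) * f x + ennreal (v / \<beta>) * g x)"
        using uv \<alpha> \<beta> by (simp add: mult.assoc[symmetric] ennreal_mult[symmetric])
      finally show ?thesis .
    qed
    have "(\<integral>\<^sup>+ x. ennreal_powr (f x) u * ennreal_powr (g x) v \<partial>M)
        \<le> (\<integral>\<^sup>+ x. c * (ennreal (u / \<alpha>) * f x + ennreal (v / \<beta>) * g x) \<partial>M)"
      by (intro nn_integral_mono pt)
    also have "\<dots> = c * (ennreal (u / \<alpha>) * A + ennreal (v / \<beta>) * B)"
      by (simp add: nn_integral_cmult nn_integral_add A_def B_def)
    also have "ennreal (u / \<alpha>) * A + ennreal (v / \<beta>) * B = ennreal 1"
      using uv \<alpha> \<beta>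
      by (simp add: ennreal_mult[symmetric] ennreal_plus[symmetric] del: ennreal_plus)
    finally show ?thesis by (simp add: cAB A_def B_def)
  qed
qed

section \<open>Suprema over radii\<close>

text \<open>
  Both maximal operators below are suprema, over all radii \<open>R > 0\<close>, of an increasing function of \<open>R\<close>
  divided by \<open>c * R ^ k\<close>.  Rational radii decreasing to \<open>R\<close> do at least as well in the limit, because
  the increasing factor does not drop and the denominator is continuous.  A countable supremum of
  measurable functions being measurable, this is what makes the maximal functions measurable.
\<close>

lemma SUP_radii_eq_Rats:
  fixes F :: "real \<Rightarrow> ennreal"
  assumes F: "\<And>r s. 0 < r \<Longrightarrow> r \<le> s \<Longrightarrow> F r \<le> F s" and c: "0 < c"
  shows "(SUP R\<in>{0<..}. ennreal (1 / (c * R ^ k)) * F R)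
    = (SUP R\<in>\<rat> \<inter> {0<..}. ennreal (1 / (c * R ^ k)) * F R)"
proof (rule antisym)
  show "(SUP R\<in>{0<..}. ennreal (1 / (c * R ^ k)) * F R)
      \<le> (SUP R\<in>\<rat> \<inter> {0<..}. ennreal (1 / (c * R ^ k)) * F R)" (is "_ \<le> ?S")
  proof (rule SUP_least)
    fix R :: real assume "R \<in> {0<..}"
    then have R: "0 < R" by simp
    have "\<exists>q\<in>\<rat>. R < q \<and> q < R + 1 / real (Suc n)" for n
      by (intro Rats_dense_in_real) simp
    then obtain q where q: "\<And>n. q n \<in> \<rat>" "\<And>n. R < q n" "\<And>n. q n < R + 1 / real (Suc n)"
      by metis
    have "q \<longlonglongrightarrow> R"
    proof (rule tendsto_sandwich[OF _ _ tendsto_const])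
      show "(\<lambda>n. R + 1 / real (Suc n)) \<longlonglongrightarrow> R"
        using tendsto_add[OF tendsto_const[of R] LIMSEQ_Suc[OF lim_1_over_n]] by simp
    qed (use q in \<open>auto intro!: always_eventually intro: less_imp_le\<close>)
    then have "(\<lambda>n. ennreal (1 / (c * q n ^ k))) \<longlonglongrightarrow> ennreal (1 / (c * R ^ k))"
      using R c by (intro tendsto_ennrealI tendsto_intros) auto
    then have lim: "(\<lambda>n. ennreal (1 / (c * q n ^ k)) * F R) \<longlonglongrightarrow> ennreal (1 / (c * R ^ k)) * F R"
      using R c by (intro tendsto_mult_ennreal tendsto_const) auto
    have "ennreal (1 / (c * q n ^ k)) * F R \<le> ?S" for n
    proof -
      have "ennreal (1 / (c * q n ^ k)) * F R \<le> ennreal (1 / (c * q n ^ k)) * F (q n)"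
        using q(2)[of n] R by (intro mult_left_mono F) auto
      also have "\<dots> \<le> ?S"
        using q[of n] R by (intro SUP_upper) (auto intro: less_trans)
      finally show ?thesis .
    qed
    then show "ennreal (1 / (c * R ^ k)) * F R \<le> ?S"
      by (intro LIMSEQ_le_const2[OF lim]) auto
  qed
qed (intro SUP_subset_mono, auto)

section \<open>The Hardy--Littlewood maximal function\<close>

definition hl_maximal :: "(real \<Rightarrow> ennreal) \<Rightarrow> real \<Rightarrow> ennreal" where
  "hl_maximal g x =
     (SUP R\<in>{0<..}. ennreal (1 / (2 * R)) * (\<integral>\<^sup>+y\<in>cball x R. g y \<partial>lborel))"

lemma borel_measurable_hl_maximal [measurable]:
  assumes [measurable]: "g \<in> borel_measurable borel"
  shows "hl_maximal g \<in> borel_measurable borel"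
proof -
  have "hl_maximal g x =
      (SUP R\<in>\<rat> \<inter> {0<..}. ennreal (1 / (2 * R)) * (\<integral>\<^sup>+y. (if dist x y \<le> R then g y else 0) \<partial>lborel))" for x
  proof -
    have "(\<integral>\<^sup>+y\<in>cball x R. g y \<partial>lborel) \<le> (\<integral>\<^sup>+y\<in>cball x S. g y \<partial>lborel)" if "R \<le> S" for R S
      using that by (intro nn_integral_mono) (auto simp: indicator_def)
    from SUP_radii_eq_Rats[of "\<lambda>R. \<integral>\<^sup>+y\<in>cball x R. g y \<partial>lborel" 2 1, OF this]
    have "hl_maximal g x = (SUP R\<in>\<rat> \<inter> {0<..}. ennreal (1 / (2 * R)) * (\<integral>\<^sup>+y\<in>cball x R. g y \<partial>lborel))"
      by (simp add: hl_maximal_def)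
    also have "\<dots> = (SUP R\<in>\<rat> \<inter> {0<..}. ennreal (1 / (2 * R)) * (\<integral>\<^sup>+y. (if dist x y \<le> R then g y else 0) \<partial>lborel))"
      by (intro SUP_cong arg_cong2[where f="(*)"] refl nn_integral_cong) (auto simp: indicator_def)
    finally show ?thesis .
  qed
  then have *: "hl_maximal g = (\<lambda>x. SUP R\<in>\<rat> \<inter> {0<..}.
      ennreal (1 / (2 * R)) * (\<integral>\<^sup>+y. (if dist x y \<le> R then g y else 0) \<partial>lborel))" by auto
  show ?thesis
    unfolding * by (intro borel_measurable_SUP countable_Int1 countable_rat) measurable
qed

text \<open>
  Each point of the superlevel set is the centre of an interval on which the average of \<open>g\<close> exceeds
  \<open>l\<close>.  By Vitali's covering lemma a countable disjoint subfamily, enlarged by the factor \<open>5\<close>, still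
  covers the superlevel set, and the integrals of \<open>g\<close> over the disjoint intervals add up to at most
  the full integral.
\<close>

lemma hl_maximal_weak_type:
  assumes [measurable]: "g \<in> borel_measurable borel" and l: "0 < l"
  shows "ennreal l * emeasure lborel {x. ennreal l < hl_maximal g x} \<le> 5 * (\<integral>\<^sup>+ x. g x \<partial>lborel)"
proof (cases "(\<integral>\<^sup>+ x. g x \<partial>lborel) = top")
  case True
  then show ?thesis by (simp add: ennreal_mult_top)
next
  case False
  then obtain I where I: "(\<integral>\<^sup>+ x. g x \<partial>lborel) = ennreal I" "0 \<le> I"
    by (cases "\<integral>\<^sup>+ x. g x \<partial>lborel") auto
  define E where "E = {x. ennreal l < hl_maximal g x}"
  have "\<exists>R>0. ennreal (2 * l * R) \<le> (\<integral>\<^sup>+y\<in>cball x R. g y \<partial>lborel)" if x: "x \<in> E" for x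
  proof -
    obtain R where R: "R > 0" "ennreal l < ennreal (1 / (2 * R)) * (\<integral>\<^sup>+y\<in>cball x R. g y \<partial>lborel)"
      using x by (auto simp: E_def hl_maximal_def less_SUP_iff)
    have "ennreal (2 * l * R) = ennreal (2 * R) * ennreal l"
      using R l by (simp add: ennreal_mult[symmetric])
    also have "\<dots> \<le> ennreal (2 * R) * (ennreal (1 / (2 * R)) * (\<integral>\<^sup>+y\<in>cball x R. g y \<partial>lborel))"
      using R(2) by (intro mult_left_mono) auto
    also have "\<dots> = (\<integral>\<^sup>+y\<in>cball x R. g y \<partial>lborel)"
      using R by (simp add: mult.assoc[symmetric] ennreal_mult[symmetric])
    finally show ?thesis using R by blast
  qed
  then obtain r where r: "\<And>x. x \<in> E \<Longrightarrow> r x > 0"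
    and rg: "\<And>x. x \<in> E \<Longrightarrow> ennreal (2 * l * r x) \<le> (\<integral>\<^sup>+y\<in>cball x (r x). g y \<partial>lborel)"
    by metis
  \<comment> \<open>Integrability of \<open>g\<close> bounds the radii, as the covering lemma requires.\<close>
  have rI: "r x \<le> I / (2 * l)" if x: "x \<in> E" for x
  proof -
    have "ennreal (2 * l * r x) \<le> (\<integral>\<^sup>+y. g y \<partial>lborel)"
      by (rule order_trans[OF rg[OF x]]) (intro nn_integral_mono, auto simp: indicator_def)
    then show ?thesis
      using I l by (simp add: ennreal_le_iff field_simps)
  qed
  obtain C where C: "countable C" "C \<subseteq> E"
    "pairwise (\<lambda>i j. disjnt (cball i (r i)) (cball j (r j))) C"
    "E \<subseteq> (\<Union>i\<in>C. cball i (5 * r i))"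
  proof (rule Vitali_covering_lemma_cballs[where S=E and K=E and a="\<lambda>x. x" and r=r and B="I / (2 * l)"])
    show "E \<subseteq> (\<Union>i\<in>E. cball i (r i))" using r by (force intro: less_imp_le)
  qed (use r rI in auto)
  have [measurable]: "E \<in> sets borel"
    unfolding E_def by measurable
  \<comment> \<open>The subfamily may be finite; indices outside its enumeration get empty sets.\<close>
  define N where "N = to_nat_on C ` C"
  define c where "c = from_nat_into C"
  have c: "c n \<in> C" if "n \<in> N" for n
    using that C(1) by (auto simp: N_def c_def)
  have cN: "\<exists>n\<in>N. c n = x" if "x \<in> C" for x
    using that C(1) by (auto simp: N_def c_def)
  have c_inj: "c m = c n \<Longrightarrow> m = n" if "m \<in> N" "n \<in> N" for m n
    using that C(1) by (auto simp: N_def c_def)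
  define A where "A n = (if n \<in> N then cball (c n) (r (c n)) else {})" for n
  define A5 where "A5 n = (if n \<in> N then cball (c n) (5 * r (c n)) else {})" for n
  have [measurable]: "A n \<in> sets borel" "A5 n \<in> sets borel" for n
    by (simp_all add: A_def A5_def)
  have disj: "disjoint_family A"
    unfolding disjoint_family_on_def
  proof (intro ballI impI)
    fix m n :: nat assume "m \<noteq> n"
    then show "A m \<inter> A n = {}"
      using C(3) c[of m] c[of n] c_inj[of m n]
      by (auto simp: A_def pairwise_def disjnt_def)
  qed
  have "E \<subseteq> (\<Union>n. A5 n)"
    using C(4) cN by (fastforce simp: A5_def)
  then have "emeasure lborel E \<le> emeasure lborel (\<Union>n. A5 n)"
    by (intro emeasure_mono) auto
  also have "\<dots> \<le> (\<Sum>n. emeasure lborel (A5 n))"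
    by (intro emeasure_subadditive_countably) auto
  finally have "ennreal l * emeasure lborel E \<le> ennreal l * (\<Sum>n. emeasure lborel (A5 n))"
    by (intro mult_left_mono) auto
  also have "\<dots> = (\<Sum>n. ennreal l * emeasure lborel (A5 n))"
    by simp
  also have "\<dots> \<le> (\<Sum>n. 5 * (\<integral>\<^sup>+y\<in>A n. g y \<partial>lborel))"
  proof (intro suminf_le)
    fix n
    show "ennreal l * emeasure lborel (A5 n) \<le> 5 * (\<integral>\<^sup>+y\<in>A n. g y \<partial>lborel)"
    proof (cases "n \<in> N")
      case True
      then have cE: "c n \<in> E" using c C by auto
      have "ennreal l * emeasure lborel (A5 n) = 5 * ennreal (2 * l * r (c n))"
        using True r[OF cE] l
        by (simp add: A5_def cball_eq_atLeastAtMost ennreal_mult[symmetric] 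
            ennreal_numeral[symmetric] del: ennreal_numeral)
      also have "\<dots> \<le> 5 * (\<integral>\<^sup>+y\<in>A n. g y \<partial>lborel)"
        using rg[OF cE] True by (intro mult_left_mono) (auto simp: A_def)
      finally show ?thesis .
    qed (simp add: A5_def)
  qed auto
  also have "\<dots> = 5 * (\<Sum>n. emeasure (density lborel g) (A n))"
    by (simp add: emeasure_density)
  also have "(\<Sum>n. emeasure (density lborel g) (A n)) = emeasure (density lborel g) (\<Union>n. A n)"
    by (intro suminf_emeasure disj) auto
  also have "\<dots> = (\<integral>\<^sup>+y\<in>(\<Union>n. A n). g y \<partial>lborel)"
    by (simp add: emeasure_density)
  also have "\<dots> \<le> (\<integral>\<^sup>+y. g y \<partial>lborel)"
    by (intro nn_integral_mono) (auto simp: indicator_def)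
  finally show ?thesis by (simp add: E_def mult_left_mono)
qed

text \<open>
  The layer-cake formula for the power \<open>y powr s\<close>, which holds also for \<open>y = \<infinity>\<close>.
\<close>

lemma nn_integral_powr_below:
  fixes y :: ennreal
  assumes s: "0 < s"
  shows "(\<integral>\<^sup>+ l. (if 0 < l \<and> ennreal l < y then ennreal (l powr (s - 1)) else 0) \<partial>lborel)
    = ennreal (1 / s) * ennreal_powr y s" (is "?I y = _")
proof -
  have fin: "?I (ennreal c) = ennreal (c powr s / s)" if c: "0 \<le> c" for c
  proof -
    have "((\<lambda>x. x powr (s - 1)) has_integral (c powr s / s)) {0<..<c}"
      using has_integral_powr_from_0[of "s - 1" c] s c by (simp add: has_integral_Icc_iff_Ioo)
    from nn_integral_has_integral_lebesgue'[OF _ this]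
    have "(\<integral>\<^sup>+ x. ennreal (x powr (s - 1)) * indicator {0<..<c} x \<partial>lborel) = ennreal (c powr s / s)"
      by simp
    also have "(\<integral>\<^sup>+ x. ennreal (x powr (s - 1)) * indicator {0<..<c} x \<partial>lborel) = ?I (ennreal c)"
      using c by (intro nn_integral_cong) (auto simp: indicator_def ennreal_less_iff)
    finally show ?thesis .
  qed
  show ?thesis
  proof (cases y)
    case (real c)
    then show ?thesis using fin[of c] s by (simp add: ennreal_mult[symmetric])
  next
    case top
    have "?I top = top"
    proof (rule ccontr)
      assume "?I top \<noteq> top"
      then obtain L where L: "?I top = ennreal L" "0 \<le> L"
        by (cases "?I top") auto
      \<comment> \<open>Chosen such that the integral up to \<open>c\<close> is \<open>L + 1\<close>.\<close>
      define c where "c = (s * (L + 1)) powr (1 / s)"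
      have "?I (ennreal c) \<le> ?I top"
        by (intro nn_integral_mono) (auto simp: ennreal_less_top)
      moreover have "?I (ennreal c) = ennreal (L + 1)"
        using fin[of c] s L by (simp add: c_def powr_powr)
      ultimately show False using L by simp
    qed
    then show ?thesis using top s by (simp add: ennreal_mult_top)
  qed
qed

text \<open>
  The truncation behind Marcinkiewicz interpolation: the part of \<open>g\<close> below \<open>l / 2\<close> contributes at most
  \<open>l / 2\<close> to every average, so where the maximal function exceeds \<open>l\<close>, that of the part above
  \<open>l / 2\<close> exceeds \<open>l / 2\<close>, and the weak-type bound applies to this part only.
\<close>

lemma hl_maximal_superlevel:
  assumes [measurable]: "g \<in> borel_measurable borel" and l: "0 < l"
  shows "ennreal l * emeasure lborel {x. ennreal l < hl_maximal g x}
    \<le> 10 * (\<integral>\<^sup>+ x. (if ennreal l < 2 * g x then g x else 0) \<partial>lborel)"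
proof -
  define g' where "g' x = (if ennreal l < 2 * g x then g x else 0)" for x
  have [measurable]: "g' \<in> borel_measurable borel"
    unfolding g'_def by measurable
  have gg': "g y \<le> g' y + ennreal (l / 2)" for y
  proof (cases "ennreal l < 2 * g y")
    case False
    then have "2 * g y \<le> ennreal l" by simp
    then have "g y \<le> ennreal (l / 2)"
      using l by (cases "g y") (auto simp: ennreal_numeral[symmetric] ennreal_mult[symmetric] ennreal_le_iff
        ennreal_mult_top top_unique simp del: ennreal_numeral)
    then show ?thesis by (simp add: add_increasing)
  qed (simp add: g'_def)
  have "hl_maximal g x \<le> hl_maximal g' x + ennreal (l / 2)" for x
    unfolding hl_maximal_def[of g]
  proof (rule SUP_least)
    fix R :: real assume "R \<in> {0<..}"
    then have R: "R > 0" by simp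
    have "(\<integral>\<^sup>+y\<in>cball x R. g y \<partial>lborel) \<le> (\<integral>\<^sup>+y. g' y * indicator (cball x R) y
        + ennreal (l / 2) * indicator (cball x R) y \<partial>lborel)"
      using gg' by (intro nn_integral_mono) (auto simp: indicator_def)
    also have "\<dots> = (\<integral>\<^sup>+y\<in>cball x R. g' y \<partial>lborel) + ennreal (l / 2) * ennreal (2 * R)"
      using R by (simp add: nn_integral_add nn_integral_cmult_indicator cball_eq_atLeastAtMost)
    finally have "ennreal (1 / (2 * R)) * (\<integral>\<^sup>+y\<in>cball x R. g y \<partial>lborel)
      \<le> ennreal (1 / (2 * R)) * ((\<integral>\<^sup>+y\<in>cball x R. g' y \<partial>lborel) + ennreal (l / 2) * ennreal (2 * R))"
      by (intro mult_left_mono) auto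
    also have "\<dots> = ennreal (1 / (2 * R)) * (\<integral>\<^sup>+y\<in>cball x R. g' y \<partial>lborel) + ennreal (l / 2)"
      using R l by (simp add: distrib_left ennreal_mult[symmetric])
    also have "\<dots> \<le> hl_maximal g' x + ennreal (l / 2)"
      unfolding hl_maximal_def using R by (intro add_right_mono SUP_upper) auto
    finally show "ennreal (1 / (2 * R)) * (\<integral>\<^sup>+y\<in>cball x R. g y \<partial>lborel) \<le> hl_maximal g' x + ennreal (l / 2)" .
  qed
  then have "ennreal (l / 2) < hl_maximal g' x" if "ennreal l < hl_maximal g x" for x
  proof -
    have "ennreal (l / 2) + ennreal (l / 2) = ennreal l"
      using l by (simp add: ennreal_plus[symmetric] del: ennreal_plus)
    then have "ennreal (l / 2) + ennreal (l / 2) < hl_maximal g' x + ennreal (l / 2)"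
      using that \<open>hl_maximal g x \<le> hl_maximal g' x + ennreal (l / 2)\<close> by (metis order_less_le_trans)
    then show ?thesis by (metis add_right_mono not_le)
  qed
  then have "ennreal (l / 2) * emeasure lborel {x. ennreal l < hl_maximal g x}
     \<le> ennreal (l / 2) * emeasure lborel {x. ennreal (l / 2) < hl_maximal g' x}"
    by (intro mult_left_mono emeasure_mono) auto
  also have "\<dots> \<le> 5 * (\<integral>\<^sup>+ x. g' x \<partial>lborel)"
    using l by (intro hl_maximal_weak_type) auto
  finally have "2 * (ennreal (l / 2) * emeasure lborel {x. ennreal l < hl_maximal g x})
      \<le> 2 * (5 * (\<integral>\<^sup>+ x. g' x \<partial>lborel))"
    by (intro mult_left_mono) auto
  also have "2 * (ennreal (l / 2) * emeasure lborel {x. ennreal l < hl_maximal g x})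
      = ennreal l * emeasure lborel {x. ennreal l < hl_maximal g x}"
    using l by (simp add: mult.assoc[symmetric] ennreal_numeral[symmetric] ennreal_mult[symmetric] del: ennreal_numeral)
  finally show ?thesis by (simp add: g'_def mult.assoc[symmetric])
qed

text \<open>
  The Hardy--Littlewood maximal theorem.  The layer-cake formula turns the integral of the \<open>q\<close>-th
  power into an integral over levels, the superlevel estimate is inserted, and the order of
  integration is exchanged back.  The remaining integral of \<open>l powr (q - 2)\<close> over
  \<open>0 < l < 2 * g x\<close> converges at \<open>0\<close> precisely because \<open>q > 1\<close>.
\<close>

lemma hl_maximal_Lp:
  assumes [measurable]: "g \<in> borel_measurable borel" and q: "1 < q"
  shows "(\<integral>\<^sup>+ x. ennreal_powr (hl_maximal g x) q \<partial>lborel)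
    \<le> ennreal (q * (10 / (q - 1) * 2 powr (q - 1))) * (\<integral>\<^sup>+ x. ennreal_powr (g x) q \<partial>lborel)"
proof -
  let ?M = "hl_maximal g"
  have lc: "ennreal_powr (?M x) q =
    ennreal q * (\<integral>\<^sup>+ l. (if 0 < l \<and> ennreal l < ?M x then ennreal (l powr (q - 1)) else 0) \<partial>lborel)" for x
    using q by (simp add: nn_integral_powr_below mult.assoc[symmetric] ennreal_mult[symmetric])
  have cake: "(\<integral>\<^sup>+ x. ennreal_powr (?M x) q \<partial>lborel)
    = ennreal q * (\<integral>\<^sup>+ x. (\<integral>\<^sup>+ l. (if 0 < l \<and> ennreal l < ?M x then ennreal (l powr (q - 1)) else 0) \<partial>lborel) \<partial>lborel)"
    unfolding lc by (intro nn_integral_cmult) measurable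
  have "(\<integral>\<^sup>+ x. (\<integral>\<^sup>+ l. (if 0 < l \<and> ennreal l < ?M x then ennreal (l powr (q - 1)) else 0) \<partial>lborel) \<partial>lborel)
    = (\<integral>\<^sup>+ l. (\<integral>\<^sup>+ x. (if 0 < l \<and> ennreal l < ?M x then ennreal (l powr (q - 1)) else 0) \<partial>lborel) \<partial>lborel)"
    by (intro lborel_pair.Fubini') measurable
  \<comment> \<open>The exponent is written \<open>q - 1 - 1\<close> to match the layer-cake formula for the power \<open>q - 1\<close>.\<close>
  also have "\<dots> \<le> (\<integral>\<^sup>+ l. (\<integral>\<^sup>+ x. 10 * (g x * (if 0 < l \<and> ennreal l < 2 * g x then ennreal (l powr (q - 1 - 1)) else 0)) \<partial>lborel) \<partial>lborel)"
  proof (rule nn_integral_mono)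
    fix l :: real
    show "(\<integral>\<^sup>+ x. (if 0 < l \<and> ennreal l < ?M x then ennreal (l powr (q - 1)) else 0) \<partial>lborel)
      \<le> (\<integral>\<^sup>+ x. 10 * (g x * (if 0 < l \<and> ennreal l < 2 * g x then ennreal (l powr (q - 1 - 1)) else 0)) \<partial>lborel)"
    proof (cases "0 < l")
      case True
      have pw: "ennreal (l powr (q - 1)) = ennreal (l powr (q - 1 - 1)) * ennreal l"
        using True powr_add[of l "q - 1 - 1" 1] by (simp add: ennreal_mult[symmetric])
      have "(\<integral>\<^sup>+ x. (if 0 < l \<and> ennreal l < ?M x then ennreal (l powr (q - 1)) else 0) \<partial>lborel)
        = (\<integral>\<^sup>+ x. ennreal (l powr (q - 1)) * indicator {x. ennreal l < ?M x} x \<partial>lborel)"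
        using True by (intro nn_integral_cong) (auto simp: indicator_def)
      also have "\<dots> = ennreal (l powr (q - 1 - 1)) * (ennreal l * emeasure lborel {x. ennreal l < ?M x})"
        by (subst nn_integral_cmult_indicator) (auto simp: pw mult.assoc)
      also have "\<dots> \<le> ennreal (l powr (q - 1 - 1)) * (10 * (\<integral>\<^sup>+ x. (if ennreal l < 2 * g x then g x else 0) \<partial>lborel))"
        using True by (intro mult_left_mono hl_maximal_superlevel) auto
      also have "\<dots> = (\<integral>\<^sup>+ x. ennreal (l powr (q - 1 - 1)) * (10 * (if ennreal l < 2 * g x then g x else 0)) \<partial>lborel)"
        by (simp add: nn_integral_cmult)
      also have "\<dots> = (\<integral>\<^sup>+ x. 10 * (g x * (if 0 < l \<and> ennreal l < 2 * g x then ennreal (l powr (q - 1 - 1)) else 0)) \<partial>lborel)"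
        using True by (intro nn_integral_cong) (auto simp: ac_simps)
      finally show ?thesis .
    qed simp
  qed
  also have "\<dots> = (\<integral>\<^sup>+ x. (\<integral>\<^sup>+ l. 10 * (g x * (if 0 < l \<and> ennreal l < 2 * g x then ennreal (l powr (q - 1 - 1)) else 0)) \<partial>lborel) \<partial>lborel)"
    by (rule lborel_pair.Fubini'[symmetric]) measurable
  also have "\<dots> = (\<integral>\<^sup>+ x. ennreal (10 / (q - 1) * 2 powr (q - 1)) * ennreal_powr (g x) q \<partial>lborel)"
  proof (intro nn_integral_cong)
    fix x
    have gp: "g x * ennreal_powr (g x) (q - 1) = ennreal_powr (g x) q"
      using ennreal_powr_add[of "g x" 1 "q - 1"] by simp
    have two: "ennreal_powr 2 (q - 1) = ennreal (2 powr (q - 1))"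
      using ennreal_powr_ennreal[of 2 "q - 1"] by simp
    have "(\<integral>\<^sup>+ l. 10 * (g x * (if 0 < l \<and> ennreal l < 2 * g x then ennreal (l powr (q - 1 - 1)) else 0)) \<partial>lborel)
      = 10 * (g x * (ennreal (1 / (q - 1)) * ennreal_powr (2 * g x) (q - 1)))"
      using q by (simp add: nn_integral_cmult nn_integral_powr_below)
    also have "\<dots> = (ennreal 10 * ennreal (1 / (q - 1)) * ennreal (2 powr (q - 1))) * (g x * ennreal_powr (g x) (q - 1))"
      by (simp only: ennreal_powr_mult two) (simp add: ac_simps)
    also have "\<dots> = ennreal (10 / (q - 1) * 2 powr (q - 1)) * ennreal_powr (g x) q"
      unfolding gp using q by (simp add: ennreal_mult[symmetric] del: ennreal_numeral)
    finally show "(\<integral>\<^sup>+ l. 10 * (g x * (if 0 < l \<and> ennreal l < 2 * g x then ennreal (l powr (q - 1 - 1)) else 0)) \<partial>lborel)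
      = ennreal (10 / (q - 1) * 2 powr (q - 1)) * ennreal_powr (g x) q" .
  qed
  also have "\<dots> = ennreal (10 / (q - 1) * 2 powr (q - 1)) * (\<integral>\<^sup>+ x. ennreal_powr (g x) q \<partial>lborel)"
    by (intro nn_integral_cmult) measurable
  finally have "(\<integral>\<^sup>+ x. ennreal_powr (?M x) q \<partial>lborel)
    \<le> ennreal q * (ennreal (10 / (q - 1) * 2 powr (q - 1)) * (\<integral>\<^sup>+ x. ennreal_powr (g x) q \<partial>lborel))"
    unfolding cake by (rule mult_left_mono) simp
  also have "\<dots> = ennreal (q * (10 / (q - 1) * 2 powr (q - 1))) * (\<integral>\<^sup>+ x. ennreal_powr (g x) q \<partial>lborel)"
    using q by (subst mult.assoc[symmetric], subst ennreal_mult[symmetric]) auto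
  finally show ?thesis .
qed

section \<open>Polar coordinates\<close>

text \<open>
  The substitution \<open>\<theta> = arctan t\<close> as an identity of measures, so that it applies to integrands with
  values in \<open>[0, \<infinity>]\<close>.  On a set it is the substitution rule on the intervals \<open>{-n..n}\<close>, followed by
  monotone convergence.
\<close>

lemma distr_arctan:
  "distr (density lborel (\<lambda>t. ennreal (1 / (1 + t\<^sup>2)))) borel arctan
    = density lborel (indicator {- pi / 2<..<pi / 2})"
proof (rule measure_eqI)
  fix A assume "A \<in> sets (distr (density lborel (\<lambda>t. ennreal (1 / (1 + t\<^sup>2)))) borel arctan)"
  then have A [measurable]: "A \<in> sets borel" by simp
  have [measurable]: "arctan \<in> borel_measurable borel"
    by (intro borel_measurable_continuous_onI continuous_intros)
  have deriv: "(arctan has_real_derivative 1 / (1 + t\<^sup>2)) (at t)" for t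
    using DERIV_arctan[of t] by (simp add: inverse_eq_divide)
  have cont: "continuous_on S (\<lambda>t::real. 1 / (1 + t\<^sup>2))" for S
    by (intro continuous_intros) (auto simp: add_nonneg_eq_0_iff)
  have eq: "(\<integral>\<^sup>+ x. indicator A x * indicator {arctan (- real n)..arctan (real n)} x \<partial>lborel)
    = (\<integral>\<^sup>+ t. ennreal (1 / (1 + t\<^sup>2)) * indicator A (arctan t) * indicator {- real n..real n} t \<partial>lborel)" for n
  proof -
    have "(\<integral>\<^sup>+ x. indicator A x * indicator {arctan (- real n)..arctan (real n)} x \<partial>lborel)
      = (\<integral>\<^sup>+ x. ennreal (indicator A x * indicator {arctan (- real n)..arctan (real n)} x) \<partial>lborel)"
      by (intro nn_integral_cong) (auto simp: indicator_def)
    also have "\<dots> = (\<integral>\<^sup>+ t. ennreal (indicator A (arctan t) * (1 / (1 + t\<^sup>2)) * indicator {- real n..real n} t) \<partial>lborel)"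
      by (rule nn_integral_substitution[OF _ deriv cont]) (auto simp: set_borel_measurable_def)
    also have "\<dots> = (\<integral>\<^sup>+ t. ennreal (1 / (1 + t\<^sup>2)) * indicator A (arctan t) * indicator {- real n..real n} t \<partial>lborel)"
      by (intro nn_integral_cong) (auto simp: indicator_def)
    finally show ?thesis .
  qed
  have "(\<lambda>n. \<integral>\<^sup>+ x. indicator A x * indicator {arctan (- real n)..arctan (real n)} x \<partial>lborel)
     \<longlonglongrightarrow> (\<integral>\<^sup>+ x. indicator A x * indicator {- pi / 2<..<pi / 2} x \<partial>lborel)"
  proof (rule nn_integral_LIMSEQ)
    show "incseq (\<lambda>n x. indicator A x * indicator {arctan (- real n)..arctan (real n)} x :: ennreal)"
      by (auto simp: incseq_def le_fun_def indicator_def dest: order_trans)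
         (meson arctan_le_iff le_minus_iff neg_le_iff_le of_nat_le_iff order_trans)+
    fix x
    have "eventually (\<lambda>n. indicator A x * indicator {arctan (- real n)..arctan (real n)} x
        = (indicator A x * indicator {- pi / 2<..<pi / 2} x :: ennreal)) sequentially"
    proof (cases "x \<in> {- pi / 2<..<pi / 2}")
      case True
      then have x: "arctan (tan x) = x" by (intro arctan_tan) auto
      have "eventually (\<lambda>n. real n \<ge> \<bar>tan x\<bar>) sequentially"
        using filterlim_real_sequentially by (simp add: filterlim_at_top)
      then show ?thesis
      proof eventually_elim
        case (elim n)
        then have "arctan (- real n) \<le> arctan (tan x)" "arctan (tan x) \<le> arctan (real n)"
          unfolding arctan_le_iff by auto
        then show ?case using True x by (auto simp: indicator_def)
      qed
    next
      case False
      have "x \<notin> {arctan (- real n)..arctan (real n)}" for n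
        using False arctan_bounded[of "real n"] arctan_bounded[of "- real n"] by auto
      then show ?thesis using False by (auto simp: indicator_def)
    qed
    then show "(\<lambda>n. indicator A x * indicator {arctan (- real n)..arctan (real n)} x)
      \<longlonglongrightarrow> (indicator A x * indicator {- pi / 2<..<pi / 2} x :: ennreal)"
      by (rule tendsto_eventually)
  qed measurable
  moreover have "(\<lambda>n. \<integral>\<^sup>+ t. ennreal (1 / (1 + t\<^sup>2)) * indicator A (arctan t) * indicator {- real n..real n} t \<partial>lborel)
     \<longlonglongrightarrow> (\<integral>\<^sup>+ t. ennreal (1 / (1 + t\<^sup>2)) * indicator A (arctan t) \<partial>lborel)"
  proof (rule nn_integral_LIMSEQ)
    show "incseq (\<lambda>n t. ennreal (1 / (1 + t\<^sup>2)) * indicator A (arctan t) * indicator {- real n..real n} t)"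
      by (auto simp: incseq_def le_fun_def indicator_def)
    fix t :: real
    have "eventually (\<lambda>n. real n \<ge> \<bar>t\<bar>) sequentially"
      using filterlim_real_sequentially by (simp add: filterlim_at_top)
    then have "eventually (\<lambda>n. ennreal (1 / (1 + t\<^sup>2)) * indicator A (arctan t) * indicator {- real n..real n} t
      = ennreal (1 / (1 + t\<^sup>2)) * indicator A (arctan t)) sequentially"
      by eventually_elim (auto simp: indicator_def)
    then show "(\<lambda>n. ennreal (1 / (1 + t\<^sup>2)) * indicator A (arctan t) * indicator {- real n..real n} t)
      \<longlonglongrightarrow> ennreal (1 / (1 + t\<^sup>2)) * indicator A (arctan t)"
      by (rule tendsto_eventually)
  qed measurable
  ultimately have lim: "(\<integral>\<^sup>+ x. indicator A x * indicator {- pi / 2<..<pi / 2} x \<partial>lborel)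
      = (\<integral>\<^sup>+ t. ennreal (1 / (1 + t\<^sup>2)) * indicator A (arctan t) \<partial>lborel)"
    unfolding eq by (rule LIMSEQ_unique)
  have [measurable]: "arctan -` A \<in> sets borel"
    by (rule measurable_sets_borel[OF _ A]) measurable
  have "emeasure (distr (density lborel (\<lambda>t. ennreal (1 / (1 + t\<^sup>2)))) borel arctan) A
    = (\<integral>\<^sup>+ t. ennreal (1 / (1 + t\<^sup>2)) * indicator (arctan -` A \<inter> space lborel) t \<partial>lborel)"
    by (simp add: emeasure_distr emeasure_density)
  also have "\<dots> = (\<integral>\<^sup>+ t. ennreal (1 / (1 + t\<^sup>2)) * indicator A (arctan t) \<partial>lborel)"
    by (intro nn_integral_cong) (auto simp: indicator_def)
  also have "\<dots> = emeasure (density lborel (indicator {- pi / 2<..<pi / 2})) A"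
    unfolding lim[symmetric] by (simp add: emeasure_density mult.commute)
  finally show "emeasure (distr (density lborel (\<lambda>t. ennreal (1 / (1 + t\<^sup>2)))) borel arctan) A
    = emeasure (density lborel (indicator {- pi / 2<..<pi / 2})) A" .
qed simp

lemma nn_integral_arctan:
  assumes [measurable]: "F \<in> borel_measurable borel"
  shows "(\<integral>\<^sup>+ t. ennreal (1 / (1 + t\<^sup>2)) * F (arctan t) \<partial>lborel) = (\<integral>\<^sup>+\<theta>\<in>{- pi / 2<..<pi / 2}. F \<theta> \<partial>lborel)"
proof -
  have [measurable]: "arctan \<in> borel_measurable borel"
    by (intro borel_measurable_continuous_onI continuous_intros)
  have "(\<integral>\<^sup>+ t. ennreal (1 / (1 + t\<^sup>2)) * F (arctan t) \<partial>lborel)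
    = (\<integral>\<^sup>+ \<theta>. F \<theta> \<partial>distr (density lborel (\<lambda>t. ennreal (1 / (1 + t\<^sup>2)))) borel arctan)"
    by (simp add: nn_integral_distr nn_integral_density)
  also have "\<dots> = (\<integral>\<^sup>+\<theta>\<in>{- pi / 2<..<pi / 2}. F \<theta> \<partial>lborel)"
    by (simp add: distr_arctan nn_integral_density mult.commute)
  finally show ?thesis .
qed

lemma nn_integral_half_line_dilation:
  fixes F :: "real \<Rightarrow> ennreal"
  assumes [measurable]: "F \<in> borel_measurable borel" and c: "0 < c"
  shows "(\<integral>\<^sup>+y\<in>{0<..}. ennreal y * F y \<partial>lborel) = ennreal (c\<^sup>2) * (\<integral>\<^sup>+r\<in>{0<..}. ennreal r * F (c * r) \<partial>lborel)"
proof -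
  have "(\<integral>\<^sup>+y\<in>{0<..}. ennreal y * F y \<partial>lborel)
    = ennreal c * (\<integral>\<^sup>+r. ennreal (c * r) * F (c * r) * indicator {0<..} (c * r) \<partial>lborel)"
    using c by (subst nn_integral_real_affine[of _ c 0]) auto
  also have "(\<integral>\<^sup>+r. ennreal (c * r) * F (c * r) * indicator {0<..} (c * r) \<partial>lborel)
    = (\<integral>\<^sup>+r. ennreal c * (ennreal r * F (c * r) * indicator {0<..} r) \<partial>lborel)"
    using c by (intro nn_integral_cong) (auto simp: indicator_def zero_less_mult_iff ennreal_mult mult.assoc)
  also have "\<dots> = ennreal c * (\<integral>\<^sup>+r\<in>{0<..}. ennreal r * F (c * r) \<partial>lborel)"
    by (intro nn_integral_cmult) measurable
  finally show ?thesis
    using c by (simp add: mult.assoc[symmetric] ennreal_mult power2_eq_square)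
qed

text \<open>
  The angles \<open>\<theta>\<close> and \<open>\<theta> + \<pi>\<close>, for \<open>\<theta>\<close> between \<open>- \<pi> / 2\<close> and \<open>\<pi> / 2\<close>, sweep out one full
  period up to two angles; the quarter of negative angles is moved by \<open>2 * \<pi>\<close>.
\<close>

lemma nn_integral_period:
  fixes H :: "real \<Rightarrow> ennreal"
  assumes [measurable]: "H \<in> borel_measurable borel" and per: "\<And>\<theta>. H (\<theta> + 2 * pi) = H \<theta>"
  shows "(\<integral>\<^sup>+\<theta>\<in>{- pi / 2<..<pi / 2}. H \<theta> + H (\<theta> + pi) \<partial>lborel) = (\<integral>\<^sup>+\<theta>\<in>{0..<2 * pi}. H \<theta> \<partial>lborel)"
proof -
  have shift: "(\<integral>\<^sup>+\<theta>. H (c + \<theta>) * indicator A (c + \<theta>) \<partial>lborel) = (\<integral>\<^sup>+\<theta>. H \<theta> * indicator A \<theta> \<partial>lborel)"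
    if [measurable]: "A \<in> sets borel" for c A
    by (subst (2) nn_integral_real_affine[of _ 1 c]) auto
  have "(\<integral>\<^sup>+\<theta>\<in>{- pi / 2<..<pi / 2}. H \<theta> + H (\<theta> + pi) \<partial>lborel)
    = (\<integral>\<^sup>+\<theta>. H (2 * pi + \<theta>) * indicator {3 * pi / 2<..<2 * pi} (2 * pi + \<theta>)
         + (H \<theta> * indicator {0..<pi / 2} \<theta> + H (pi + \<theta>) * indicator {pi / 2<..<3 * pi / 2} (pi + \<theta>)) \<partial>lborel)"
    using per by (intro nn_integral_cong) (auto simp: indicator_def add.commute)
  also have "\<dots> = (\<integral>\<^sup>+\<theta>. H \<theta> * indicator {3 * pi / 2<..<2 * pi} \<theta> \<partial>lborel)
     + ((\<integral>\<^sup>+\<theta>. H \<theta> * indicator {0..<pi / 2} \<theta> \<partial>lborel) + (\<integral>\<^sup>+\<theta>. H \<theta> * indicator {pi / 2<..<3 * pi / 2} \<theta> \<partial>lborel))"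
    by (simp add: nn_integral_add shift)
  also have "\<dots> = (\<integral>\<^sup>+\<theta>. H \<theta> * indicator {3 * pi / 2<..<2 * pi} \<theta>
     + (H \<theta> * indicator {0..<pi / 2} \<theta> + H \<theta> * indicator {pi / 2<..<3 * pi / 2} \<theta>) \<partial>lborel)"
    by (simp add: nn_integral_add)
  also have "\<dots> = (\<integral>\<^sup>+\<theta>\<in>{0..<2 * pi}. H \<theta> \<partial>lborel)"
  proof (rule nn_integral_cong_AE)
    have "AE \<theta> in lborel. \<theta> \<noteq> pi / 2 \<and> \<theta> \<noteq> 3 * pi / 2"
      by (intro AE_conjI AE_lborel_singleton)
    then show "AE \<theta> in lborel. H \<theta> * indicator {3 * pi / 2<..<2 * pi} \<theta>
     + (H \<theta> * indicator {0..<pi / 2} \<theta> + H \<theta> * indicator {pi / 2<..<3 * pi / 2} \<theta>) = H \<theta> * indicator {0..<2 * pi} \<theta>"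
    proof eventually_elim
      case (elim \<theta>)
      have "pi > 0" by simp
      then show ?case using elim by (auto simp: indicator_def)
    qed
  qed
  finally show ?thesis .
qed

text \<open>
  Polar coordinates in the plane.  The proof parametrises a point by its first coordinate \<open>y\<close> and the
  slope \<open>t\<close> of its line through the origin, so that only one-dimensional substitutions and Tonelli's theorem are
  needed: \<open>y\<^sub>2 = y * t\<close> gives the factor \<open>\<bar>y\<bar>\<close>; along the two half-lines of slope \<open>t = tan \<theta>\<close> one
  puts \<open>y = \<plusminus> r * cos \<theta>\<close>, which gives \<open>r * (cos \<theta>)\<^sup>2\<close>; and \<open>(cos \<theta>)\<^sup>2 = 1 / (1 + t\<^sup>2)\<close> is the
  derivative of \<open>\<theta> = arctan t\<close>.
\<close>

lemma nn_integral_polar: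
  fixes F :: "real \<times> real \<Rightarrow> ennreal"
  assumes [measurable]: "F \<in> borel_measurable borel"
  shows "(\<integral>\<^sup>+ y. F y \<partial>lborel)
    = (\<integral>\<^sup>+\<theta>\<in>{0..<2 * pi}. (\<integral>\<^sup>+r\<in>{0<..}. ennreal r * F (r * cos \<theta>, r * sin \<theta>) \<partial>lborel) \<partial>lborel)"
proof -
  define H where "H \<theta> = (\<integral>\<^sup>+r\<in>{0<..}. ennreal r * F (r * cos \<theta>, r * sin \<theta>) \<partial>lborel)" for \<theta>
  have [measurable]: "F \<in> borel_measurable (borel \<Otimes>\<^sub>M borel)"
    using assms by (simp add: borel_prod)
  have [measurable]: "H \<in> borel_measurable borel"
    unfolding H_def by measurable
  have ray: "(\<integral>\<^sup>+ y. ennreal \<bar>y\<bar> * F (y, y * t) \<partial>lborel)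
      = ennreal (1 / (1 + t\<^sup>2)) * (H (arctan t) + H (arctan t + pi))" for t
  proof -
    define c where "c = cos (arctan t)"
    have c: "c > 0" "c\<^sup>2 = 1 / (1 + t\<^sup>2)" "sin (arctan t) = c * t"
      by (auto simp: c_def cos_arctan sin_arctan power_divide)
         (simp add: add_pos_nonneg)
    have "(\<integral>\<^sup>+ y. ennreal \<bar>y\<bar> * F (y, y * t) \<partial>lborel)
      = (\<integral>\<^sup>+ y. ennreal y * F (y, y * t) * indicator {0<..} y
             + ennreal (- y) * F (y, y * t) * indicator {0<..} (- y) \<partial>lborel)"
      by (intro nn_integral_cong) (auto simp: indicator_def)
    also have "\<dots> = (\<integral>\<^sup>+y\<in>{0<..}. ennreal y * F (y, y * t) \<partial>lborel)
        + (\<integral>\<^sup>+ y. ennreal (- y) * F (y, y * t) * indicator {0<..} (- y) \<partial>lborel)"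
      by (intro nn_integral_add) measurable
    also have "(\<integral>\<^sup>+ y. ennreal (- y) * F (y, y * t) * indicator {0<..} (- y) \<partial>lborel)
        = (\<integral>\<^sup>+y\<in>{0<..}. ennreal y * F (- y, - (y * t)) \<partial>lborel)"
      by (subst nn_integral_real_affine[of _ "-1" 0]) auto
    also have "(\<integral>\<^sup>+y\<in>{0<..}. ennreal y * F (y, y * t) \<partial>lborel)
        = ennreal (c\<^sup>2) * (\<integral>\<^sup>+r\<in>{0<..}. ennreal r * F (c * r, c * r * t) \<partial>lborel)"
      using nn_integral_half_line_dilation[of "\<lambda>y. F (y, y * t)" c] c by simp
    also have "(\<integral>\<^sup>+r\<in>{0<..}. ennreal r * F (c * r, c * r * t) \<partial>lborel) = H (arctan t)"
      by (simp add: H_def c(3) c_def[symmetric] mult_ac)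
    also have "(\<integral>\<^sup>+y\<in>{0<..}. ennreal y * F (- y, - (y * t)) \<partial>lborel)
        = ennreal (c\<^sup>2) * (\<integral>\<^sup>+r\<in>{0<..}. ennreal r * F (- (c * r), - (c * r * t)) \<partial>lborel)"
      using nn_integral_half_line_dilation[of "\<lambda>y. F (- y, - (y * t))" c] c by simp
    also have "(\<integral>\<^sup>+r\<in>{0<..}. ennreal r * F (- (c * r), - (c * r * t)) \<partial>lborel) = H (arctan t + pi)"
      by (simp add: H_def c(3) c_def[symmetric] mult_ac)
    finally show ?thesis by (simp add: c(2) distrib_left)
  qed
  have "(\<integral>\<^sup>+ y. F y \<partial>lborel) = (\<integral>\<^sup>+ y. F y \<partial>(lborel \<Otimes>\<^sub>M lborel))"
    by (simp add: lborel_prod)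
  also have "\<dots> = (\<integral>\<^sup>+ y\<^sub>1. (\<integral>\<^sup>+ y\<^sub>2. F (y\<^sub>1, y\<^sub>2) \<partial>lborel) \<partial>lborel)"
    by (rule lborel.nn_integral_fst[symmetric]) measurable
  also have "\<dots> = (\<integral>\<^sup>+ y. (\<integral>\<^sup>+ t. ennreal \<bar>y\<bar> * F (y, y * t) \<partial>lborel) \<partial>lborel)"
  proof (rule nn_integral_cong_AE)
    show "AE y in lborel. (\<integral>\<^sup>+ y\<^sub>2. F (y, y\<^sub>2) \<partial>lborel) = (\<integral>\<^sup>+ t. ennreal \<bar>y\<bar> * F (y, y * t) \<partial>lborel)"
      using AE_lborel_singleton[of 0]
    proof eventually_elim
      case (elim y)
      then show ?case
        by (subst nn_integral_real_affine[of _ y 0]) (auto simp: nn_integral_cmult)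
    qed
  qed
  also have "\<dots> = (\<integral>\<^sup>+ t. (\<integral>\<^sup>+ y. ennreal \<bar>y\<bar> * F (y, y * t) \<partial>lborel) \<partial>lborel)"
    by (rule lborel_pair.Fubini'[symmetric]) measurable
  also have "\<dots> = (\<integral>\<^sup>+\<theta>\<in>{- pi / 2<..<pi / 2}. H \<theta> + H (\<theta> + pi) \<partial>lborel)"
    unfolding ray by (intro nn_integral_arctan) measurable
  also have "\<dots> = (\<integral>\<^sup>+\<theta>\<in>{0..<2 * pi}. H \<theta> \<partial>lborel)"
    by (rule nn_integral_period) (simp_all add: H_def)
  finally show ?thesis unfolding H_def .
qed

lemma AE_cos_sin_nonzero: "AE \<theta> in lborel. cos \<theta> \<noteq> 0 \<and> sin \<theta> \<noteq> (0::real)"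
proof (rule AE_I')
  have "{\<theta>. cos \<theta> = 0} \<subseteq> range (\<lambda>i::int. of_int i * pi + pi / 2)"
    and "{\<theta>. sin \<theta> = 0} \<subseteq> range (\<lambda>i::int. of_int i * pi)"
    by (auto simp: cos_zero_iff_int2 sin_zero_iff_int2)
  then have "countable ({\<theta>. cos \<theta> = 0} \<union> {\<theta>::real. sin \<theta> = 0})"
    by (intro countable_Un) (erule countable_subset, simp)+
  then show "{\<theta>. cos \<theta> = 0} \<union> {\<theta>::real. sin \<theta> = 0} \<in> null_sets lborel"
    by (rule countable_imp_null_set_lborel)
qed auto

lemma norm_polar: "0 < r \<Longrightarrow> norm (r * cos \<theta>, r * sin \<theta>) = (r :: real)"
proof -
  assume "0 < r"
  then have "norm (r *\<^sub>R (cos \<theta>, sin \<theta>)) = r"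
    by (simp only: norm_scaleR) (simp add: norm_Pair)
  then show ?thesis by simp
qed

lemma direction_polar:
  "0 < r \<Longrightarrow> (r * cos \<theta>, r * sin \<theta>) /\<^sub>R norm (r * cos \<theta>, r * sin \<theta>) = (cos \<theta>, sin \<theta> :: real)"
  by (simp add: norm_polar)

section \<open>The rough maximal operator on Borel functions\<close>

text \<open>
  The maximal function does not see the speed \<open>c\<close> of the ray: the average of \<open>h\<close> over times in
  \<open>{0<..R}\<close> is an average over an interval of length \<open>R * \<bar>c\<bar>\<close> with one end at \<open>x\<close>, which is half of the
  centred interval of radius \<open>R * \<bar>c\<bar>\<close>.  The bound is therefore uniform in the direction.
\<close>

lemma nn_integral_ray_le:
  assumes [measurable]: "h \<in> borel_measurable borel" and c: "c \<noteq> 0" and R: "0 < R"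
  shows "(\<integral>\<^sup>+r\<in>{0<..R}. h (x - r * c) \<partial>lborel) \<le> ennreal (2 * R) * hl_maximal h x"
proof -
  have [measurable]: "cball x (R * \<bar>c\<bar>) \<in> sets borel" by simp
  have "(\<integral>\<^sup>+r\<in>{0<..R}. h (x - r * c) \<partial>lborel)
      \<le> (\<integral>\<^sup>+r. h (x + - c * r) * indicator (cball x (R * \<bar>c\<bar>)) (x + - c * r) \<partial>lborel)"
    using c by (intro nn_integral_mono)
      (auto simp: indicator_def dist_real_def abs_mult mult.commute intro!: mult_right_mono)
  also have "\<dots> = ennreal (2 * R) * (ennreal (1 / (2 * (R * \<bar>c\<bar>))) * (ennreal \<bar>- c\<bar> *
      (\<integral>\<^sup>+r. h (x + - c * r) * indicator (cball x (R * \<bar>c\<bar>)) (x + - c * r) \<partial>lborel)))"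
    using c R by (simp add: mult.assoc[symmetric] ennreal_mult[symmetric])
  also have "ennreal \<bar>- c\<bar> * (\<integral>\<^sup>+r. h (x + - c * r) * indicator (cball x (R * \<bar>c\<bar>)) (x + - c * r) \<partial>lborel)
      = (\<integral>\<^sup>+y\<in>cball x (R * \<bar>c\<bar>). h y \<partial>lborel)"
    using c by (intro nn_integral_real_affine[symmetric]) measurable
  also have "ennreal (1 / (2 * (R * \<bar>c\<bar>))) * \<dots> \<le> hl_maximal h x"
    unfolding hl_maximal_def using c R by (intro SUP_upper) auto
  finally show ?thesis by (simp add: mult_left_mono)
qed

lemma nn_integral_ray_product_le:
  assumes [measurable]: "h\<^sub>1 \<in> borel_measurable borel" "h\<^sub>2 \<in> borel_measurable borel"
    and uv: "0 < u" "0 < v" "u + v = 1" and c: "c\<^sub>1 \<noteq> 0" "c\<^sub>2 \<noteq> 0" and R: "0 < R"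
  shows "(\<integral>\<^sup>+r\<in>{0<..R}. ennreal_powr (h\<^sub>1 (x - r * c\<^sub>1)) u * ennreal_powr (h\<^sub>2 (x - r * c\<^sub>2)) v \<partial>lborel)
    \<le> ennreal (2 * R) * (ennreal_powr (hl_maximal h\<^sub>1 x) u * ennreal_powr (hl_maximal h\<^sub>2 x) v)"
proof -
  have "(\<integral>\<^sup>+r\<in>{0<..R}. ennreal_powr (h\<^sub>1 (x - r * c\<^sub>1)) u * ennreal_powr (h\<^sub>2 (x - r * c\<^sub>2)) v \<partial>lborel)
    = (\<integral>\<^sup>+r. ennreal_powr (h\<^sub>1 (x - r * c\<^sub>1) * indicator {0<..R} r) u
          * ennreal_powr (h\<^sub>2 (x - r * c\<^sub>2) * indicator {0<..R} r) v \<partial>lborel)"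
    by (intro nn_integral_cong) (auto simp: indicator_def)
  also have "\<dots> \<le> ennreal_powr (\<integral>\<^sup>+r\<in>{0<..R}. h\<^sub>1 (x - r * c\<^sub>1) \<partial>lborel) u
                * ennreal_powr (\<integral>\<^sup>+r\<in>{0<..R}. h\<^sub>2 (x - r * c\<^sub>2) \<partial>lborel) v"
    by (intro Hoelder_nn_integral uv) measurable
  also have "\<dots> \<le> ennreal_powr (ennreal (2 * R) * hl_maximal h\<^sub>1 x) u
                * ennreal_powr (ennreal (2 * R) * hl_maximal h\<^sub>2 x) v"
    using uv c R by (intro mult_mono ennreal_powr_mono nn_integral_ray_le) auto
  also have "\<dots> = ennreal_powr (ennreal (2 * R)) (u + v)
                * (ennreal_powr (hl_maximal h\<^sub>1 x) u * ennreal_powr (hl_maximal h\<^sub>2 x) v)"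
    by (simp only: ennreal_powr_mult ennreal_powr_add mult_ac)
  finally show ?thesis using uv by simp
qed

text \<open>
  In polar coordinates the average becomes an integral over directions of integrals along rays.  The
  Jacobian \<open>r \<le> R\<close> cancels one of the two factors \<open>1 / R\<close>, and the ray averages are bounded by the same
  product of maximal functions in every direction that is not parallel to an axis.
\<close>

lemma rough_average_le:
  assumes [measurable]: "w \<in> borel_measurable borel"
      "h\<^sub>1 \<in> borel_measurable borel" "h\<^sub>2 \<in> borel_measurable borel"
    and uv: "0 < u" "0 < v" "u + v = 1" and R: "0 < R"
  shows "ennreal (1 / R\<^sup>2) * (\<integral>\<^sup>+y\<in>cball 0 R. w (y /\<^sub>R norm y)
        * (ennreal_powr (h\<^sub>1 (x - fst y)) u * ennreal_powr (h\<^sub>2 (x - snd y)) v) \<partial>lborel)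
    \<le> 2 * (\<integral>\<^sup>+\<theta>\<in>{0..<2 * pi}. w (cos \<theta>, sin \<theta>) \<partial>lborel)
        * (ennreal_powr (hl_maximal h\<^sub>1 x) u * ennreal_powr (hl_maximal h\<^sub>2 x) v)"
proof -
  have [measurable]: "cball (0 :: real \<times> real) R \<in> sets borel" by simp
  define P where "P = ennreal_powr (hl_maximal h\<^sub>1 x) u * ennreal_powr (hl_maximal h\<^sub>2 x) v"
  define G where "G y = ennreal_powr (h\<^sub>1 (x - fst y)) u * ennreal_powr (h\<^sub>2 (x - snd y)) v" for y
  have [measurable]: "G \<in> borel_measurable borel"
    unfolding G_def by (simp add: borel_prod[symmetric])
  have [measurable]: "w \<in> borel_measurable (borel \<Otimes>\<^sub>M borel)" "G \<in> borel_measurable (borel \<Otimes>\<^sub>M borel)"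
    by (simp_all add: borel_prod)
  have "(\<integral>\<^sup>+y\<in>cball 0 R. w (y /\<^sub>R norm y) * G y \<partial>lborel)
    = (\<integral>\<^sup>+\<theta>\<in>{0..<2 * pi}. (\<integral>\<^sup>+r\<in>{0<..}. ennreal r *
        (w ((r * cos \<theta>, r * sin \<theta>) /\<^sub>R norm (r * cos \<theta>, r * sin \<theta>)) * G (r * cos \<theta>, r * sin \<theta>)
          * indicator (cball 0 R) (r * cos \<theta>, r * sin \<theta>)) \<partial>lborel) \<partial>lborel)"
    by (rule nn_integral_polar) measurable
  also have "\<dots> \<le> (\<integral>\<^sup>+\<theta>. w (cos \<theta>, sin \<theta>) * indicator {0..<2 * pi} \<theta> * (ennreal R * (ennreal (2 * R) * P)) \<partial>lborel)"
  proof (rule nn_integral_mono_AE)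
    show "AE \<theta> in lborel. (\<integral>\<^sup>+r\<in>{0<..}. ennreal r *
        (w ((r * cos \<theta>, r * sin \<theta>) /\<^sub>R norm (r * cos \<theta>, r * sin \<theta>)) * G (r * cos \<theta>, r * sin \<theta>)
          * indicator (cball 0 R) (r * cos \<theta>, r * sin \<theta>)) \<partial>lborel) * indicator {0..<2 * pi} \<theta>
      \<le> w (cos \<theta>, sin \<theta>) * indicator {0..<2 * pi} \<theta> * (ennreal R * (ennreal (2 * R) * P))"
      using AE_cos_sin_nonzero
    proof eventually_elim
      case (elim \<theta>)
      have "(\<integral>\<^sup>+r\<in>{0<..}. ennreal r *
        (w ((r * cos \<theta>, r * sin \<theta>) /\<^sub>R norm (r * cos \<theta>, r * sin \<theta>)) * G (r * cos \<theta>, r * sin \<theta>)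
          * indicator (cball 0 R) (r * cos \<theta>, r * sin \<theta>)) \<partial>lborel)
        \<le> (\<integral>\<^sup>+r. (w (cos \<theta>, sin \<theta>) * ennreal R) * (G (r * cos \<theta>, r * sin \<theta>) * indicator {0<..R} r) \<partial>lborel)"
      proof (rule nn_integral_mono)
        fix r :: real
        show "ennreal r * (w ((r * cos \<theta>, r * sin \<theta>) /\<^sub>R norm (r * cos \<theta>, r * sin \<theta>)) * G (r * cos \<theta>, r * sin \<theta>)
            * indicator (cball 0 R) (r * cos \<theta>, r * sin \<theta>)) * indicator {0<..} r
          \<le> (w (cos \<theta>, sin \<theta>) * ennreal R) * (G (r * cos \<theta>, r * sin \<theta>) * indicator {0<..R} r)"
        proof (cases "0 < r \<and> r \<le> R")
          case True
          then have "ennreal r * (w (cos \<theta>, sin \<theta>) * G (r * cos \<theta>, r * sin \<theta>))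
              \<le> ennreal R * (w (cos \<theta>, sin \<theta>) * G (r * cos \<theta>, r * sin \<theta>))"
            by (intro mult_right_mono ennreal_leI) auto
          then show ?thesis
            unfolding direction_polar[OF conjunct1[OF True]] using True by (simp add: norm_polar mult_ac)
        qed (auto simp: indicator_def norm_polar)
      qed
      also have "\<dots> = (w (cos \<theta>, sin \<theta>) * ennreal R) * (\<integral>\<^sup>+r\<in>{0<..R}. G (r * cos \<theta>, r * sin \<theta>) \<partial>lborel)"
        by (intro nn_integral_cmult) measurable
      also have "\<dots> \<le> (w (cos \<theta>, sin \<theta>) * ennreal R) * (ennreal (2 * R) * P)"
        unfolding G_def P_def fst_conv snd_conv using elim uv R
        by (intro mult_left_mono nn_integral_ray_product_le) auto
      finally show ?case by (auto simp: indicator_def mult.assoc)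
    qed
  qed
  also have "\<dots> = (\<integral>\<^sup>+\<theta>\<in>{0..<2 * pi}. w (cos \<theta>, sin \<theta>) \<partial>lborel) * (ennreal R * (ennreal (2 * R) * P))"
    by (intro nn_integral_multc) measurable
  finally have "ennreal (1 / R\<^sup>2) * (\<integral>\<^sup>+y\<in>cball 0 R. w (y /\<^sub>R norm y) * G y \<partial>lborel)
    \<le> ennreal (1 / R\<^sup>2) * ((\<integral>\<^sup>+\<theta>\<in>{0..<2 * pi}. w (cos \<theta>, sin \<theta>) \<partial>lborel) * (ennreal R * (ennreal (2 * R) * P)))"
    by (intro mult_left_mono) auto
  also have "\<dots> = (ennreal (1 / R\<^sup>2) * ennreal R * ennreal (2 * R)) * (\<integral>\<^sup>+\<theta>\<in>{0..<2 * pi}. w (cos \<theta>, sin \<theta>) \<partial>lborel) * P"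
    by (simp only: mult_ac)
  also have "ennreal (1 / R\<^sup>2) * ennreal R * ennreal (2 * R) = 2"
    using R by (simp add: ennreal_mult[symmetric] power2_eq_square)
  finally show ?thesis by (simp add: G_def P_def)
qed

text \<open>
  The operator of the theorem for moduli in \<open>[0, \<infinity>]\<close> and the uncompleted Lebesgue measure: with
  Borel data Tonelli's theorem applies directly.
\<close>

definition borel_rough_maximal ::
    "(real \<times> real \<Rightarrow> ennreal) \<Rightarrow> (real \<Rightarrow> ennreal) \<Rightarrow> (real \<Rightarrow> ennreal) \<Rightarrow> real \<Rightarrow> ennreal" where
  "borel_rough_maximal w g\<^sub>1 g\<^sub>2 x = (SUP R\<in>{0<..}. ennreal (1 / R\<^sup>2) *
     (\<integral>\<^sup>+y\<in>cball 0 R. w (y /\<^sub>R norm y) * (g\<^sub>1 (x - fst y) * g\<^sub>2 (x - snd y)) \<partial>lborel))"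

lemma borel_measurable_borel_rough_maximal:
  assumes [measurable]: "w \<in> borel_measurable borel"
      "g\<^sub>1 \<in> borel_measurable borel" "g\<^sub>2 \<in> borel_measurable borel"
  shows "borel_rough_maximal w g\<^sub>1 g\<^sub>2 \<in> borel_measurable borel"
proof -
  let ?A = "\<lambda>x R. \<integral>\<^sup>+y\<in>cball 0 R. w (y /\<^sub>R norm y) * (g\<^sub>1 (x - fst y) * g\<^sub>2 (x - snd y)) \<partial>lborel"
  have "borel_rough_maximal w g\<^sub>1 g\<^sub>2 x = (SUP R\<in>\<rat> \<inter> {0<..}. ennreal (1 / R\<^sup>2) * ?A x R)" for x
  proof -
    have "?A x R \<le> ?A x S" if "R \<le> S" for R S
      using that by (intro nn_integral_mono) (auto simp: indicator_def)
    from SUP_radii_eq_Rats[of "?A x" 1 2, OF this] show ?thesis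
      by (simp add: borel_rough_maximal_def)
  qed
  then have *: "borel_rough_maximal w g\<^sub>1 g\<^sub>2 = (\<lambda>x. SUP R\<in>\<rat> \<inter> {0<..}. ennreal (1 / R\<^sup>2) * ?A x R)"
    by auto
  have [measurable]: "cball (0 :: real \<times> real) R \<in> sets borel" for R by simp
  have [measurable]: "fst \<in> borel_measurable (borel :: (real \<times> real) measure)"
      "snd \<in> borel_measurable (borel :: (real \<times> real) measure)"
    by (simp_all add: borel_prod[symmetric])
  have [measurable]: "(\<lambda>x. ?A x R) \<in> borel_measurable borel" for R
    by (intro lborel.borel_measurable_nn_integral) measurable
  show ?thesis
    unfolding * by (intro borel_measurable_SUP countable_Int1 countable_rat) measurable
qed

text \<open>
  With \<open>u = p / p\<^sub>1\<close> and \<open>v = p / p\<^sub>2\<close> the hypothesis on the exponents says \<open>u + v = 1\<close>.  The functions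
  \<open>h\<^sub>1 = g\<^sub>1 powr (1 / u)\<close> and \<open>h\<^sub>2 = g\<^sub>2 powr (1 / v)\<close> then have \<open>p\<close>-th powers \<open>g\<^sub>1 powr p\<^sub>1\<close> and
  \<open>g\<^sub>2 powr p\<^sub>2\<close>, so that the pointwise bound, Hoelder's inequality with the same weights and the
  maximal theorem in the single space \<open>L\<^sup>p\<close> give the estimate.
\<close>

lemma borel_rough_maximal_Lp:
  assumes [measurable]: "w \<in> borel_measurable borel"
      "g\<^sub>1 \<in> borel_measurable borel" "g\<^sub>2 \<in> borel_measurable borel"
    and p: "1 < p\<^sub>1" "1 < p\<^sub>2" "1 < p" "1 / p = 1 / p\<^sub>1 + 1 / p\<^sub>2"
  defines "A \<equiv> p * (10 / (p - 1) * 2 powr (p - 1))"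
  shows "ennreal_powr (\<integral>\<^sup>+ x. ennreal_powr (borel_rough_maximal w g\<^sub>1 g\<^sub>2 x) p \<partial>lborel) (1 / p)
    \<le> ennreal (2 * A powr (1 / p)) * (\<integral>\<^sup>+\<theta>\<in>{0..<2 * pi}. w (cos \<theta>, sin \<theta>) \<partial>lborel)
       * ennreal_powr (\<integral>\<^sup>+ x. ennreal_powr (g\<^sub>1 x) p\<^sub>1 \<partial>lborel) (1 / p\<^sub>1)
       * ennreal_powr (\<integral>\<^sup>+ x. ennreal_powr (g\<^sub>2 x) p\<^sub>2 \<partial>lborel) (1 / p\<^sub>2)"
proof -
  define u v where "u = p / p\<^sub>1" and "v = p / p\<^sub>2"
  have uv: "0 < u" "0 < v" "u + v = 1"
  proof -
    have "u + v = p * (1 / p\<^sub>1 + 1 / p\<^sub>2)"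
      by (simp add: u_def v_def distrib_left)
    also have "\<dots> = 1"
      using p(3) by (simp only: p(4)[symmetric]) simp
    finally show "u + v = 1" .
  qed (use p in \<open>auto simp: u_def v_def\<close>)
  have A: "0 < A" using p by (simp add: A_def)
  define h\<^sub>1 h\<^sub>2 where "h\<^sub>1 x = ennreal_powr (g\<^sub>1 x) (1 / u)" and "h\<^sub>2 x = ennreal_powr (g\<^sub>2 x) (1 / v)" for x
  have [measurable]: "h\<^sub>1 \<in> borel_measurable borel" "h\<^sub>2 \<in> borel_measurable borel"
    unfolding h\<^sub>1_def h\<^sub>2_def by measurable
  have g: "g\<^sub>1 x = ennreal_powr (h\<^sub>1 x) u" "g\<^sub>2 x = ennreal_powr (h\<^sub>2 x) v" for x
    using uv by (simp_all add: h\<^sub>1_def h\<^sub>2_def ennreal_powr_powr)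
  define W where "W = (\<integral>\<^sup>+\<theta>\<in>{0..<2 * pi}. w (cos \<theta>, sin \<theta>) \<partial>lborel)"
  let ?m\<^sub>1 = "hl_maximal h\<^sub>1" and ?m\<^sub>2 = "hl_maximal h\<^sub>2"
  have pt: "borel_rough_maximal w g\<^sub>1 g\<^sub>2 x \<le> 2 * W * (ennreal_powr (?m\<^sub>1 x) u * ennreal_powr (?m\<^sub>2 x) v)" for x
    unfolding borel_rough_maximal_def g W_def
    using uv by (intro SUP_least rough_average_le) auto
  have "(\<integral>\<^sup>+ x. ennreal_powr (borel_rough_maximal w g\<^sub>1 g\<^sub>2 x) p \<partial>lborel)
    \<le> (\<integral>\<^sup>+ x. ennreal_powr (2 * W * (ennreal_powr (?m\<^sub>1 x) u * ennreal_powr (?m\<^sub>2 x) v)) p \<partial>lborel)"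
    using p by (intro nn_integral_mono ennreal_powr_mono pt) auto
  also have "\<dots> = (\<integral>\<^sup>+ x. ennreal_powr (2 * W) p *
      (ennreal_powr (ennreal_powr (?m\<^sub>1 x) p) u * ennreal_powr (ennreal_powr (?m\<^sub>2 x) p) v) \<partial>lborel)"
    by (simp only: ennreal_powr_mult ennreal_powr_powr mult.commute[of p])
  also have "\<dots> = ennreal_powr (2 * W) p *
      (\<integral>\<^sup>+ x. ennreal_powr (ennreal_powr (?m\<^sub>1 x) p) u * ennreal_powr (ennreal_powr (?m\<^sub>2 x) p) v \<partial>lborel)"
    by (intro nn_integral_cmult) measurable
  also have "\<dots> \<le> ennreal_powr (2 * W) p * (ennreal_powr (\<integral>\<^sup>+ x. ennreal_powr (?m\<^sub>1 x) p \<partial>lborel) u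
      * ennreal_powr (\<integral>\<^sup>+ x. ennreal_powr (?m\<^sub>2 x) p \<partial>lborel) v)"
    by (intro mult_left_mono Hoelder_nn_integral uv) auto
  also have "\<dots> \<le> ennreal_powr (2 * W) p *
      (ennreal_powr (ennreal A * (\<integral>\<^sup>+ x. ennreal_powr (h\<^sub>1 x) p \<partial>lborel)) u
      * ennreal_powr (ennreal A * (\<integral>\<^sup>+ x. ennreal_powr (h\<^sub>2 x) p \<partial>lborel)) v)"
    unfolding A_def using uv p by (intro mult_left_mono mult_mono ennreal_powr_mono hl_maximal_Lp) auto
  also have "\<dots> = ennreal_powr (2 * W) p * (ennreal_powr (ennreal A) (u + v) *
      (ennreal_powr (\<integral>\<^sup>+ x. ennreal_powr (h\<^sub>1 x) p \<partial>lborel) u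
      * ennreal_powr (\<integral>\<^sup>+ x. ennreal_powr (h\<^sub>2 x) p \<partial>lborel) v))"
    by (simp only: ennreal_powr_mult ennreal_powr_add mult_ac)
  also have "(\<integral>\<^sup>+ x. ennreal_powr (h\<^sub>1 x) p \<partial>lborel) = (\<integral>\<^sup>+ x. ennreal_powr (g\<^sub>1 x) p\<^sub>1 \<partial>lborel)"
    using p by (simp add: h\<^sub>1_def ennreal_powr_powr u_def)
  also have "(\<integral>\<^sup>+ x. ennreal_powr (h\<^sub>2 x) p \<partial>lborel) = (\<integral>\<^sup>+ x. ennreal_powr (g\<^sub>2 x) p\<^sub>2 \<partial>lborel)"
    using p by (simp add: h\<^sub>2_def ennreal_powr_powr v_def)
  finally have "ennreal_powr (\<integral>\<^sup>+ x. ennreal_powr (borel_rough_maximal w g\<^sub>1 g\<^sub>2 x) p \<partial>lborel) (1 / p)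
    \<le> ennreal_powr (ennreal_powr (2 * W) p * (ennreal_powr (ennreal A) (u + v) *
      (ennreal_powr (\<integral>\<^sup>+ x. ennreal_powr (g\<^sub>1 x) p\<^sub>1 \<partial>lborel) u
      * ennreal_powr (\<integral>\<^sup>+ x. ennreal_powr (g\<^sub>2 x) p\<^sub>2 \<partial>lborel) v))) (1 / p)"
    using p(3) by (intro ennreal_powr_mono) auto
  also have "\<dots> = 2 * W * (ennreal (A powr (1 / p)) *
      (ennreal_powr (\<integral>\<^sup>+ x. ennreal_powr (g\<^sub>1 x) p\<^sub>1 \<partial>lborel) (1 / p\<^sub>1)
      * ennreal_powr (\<integral>\<^sup>+ x. ennreal_powr (g\<^sub>2 x) p\<^sub>2 \<partial>lborel) (1 / p\<^sub>2)))"
    using p(1-3) A by (simp add: uv(3) ennreal_powr_mult ennreal_powr_powr) (simp add: u_def v_def)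
  also have "\<dots> = ennreal (2 * A powr (1 / p)) * W
       * ennreal_powr (\<integral>\<^sup>+ x. ennreal_powr (g\<^sub>1 x) p\<^sub>1 \<partial>lborel) (1 / p\<^sub>1)
       * ennreal_powr (\<integral>\<^sup>+ x. ennreal_powr (g\<^sub>2 x) p\<^sub>2 \<partial>lborel) (1 / p\<^sub>2)"
    by (simp add: ennreal_mult mult_ac)
  finally show ?thesis by (simp add: W_def)
qed

section \<open>Reduction to Borel representatives\<close>

text \<open>
  Arc length before completion, for which almost-everywhere statements have Borel exceptional sets.
\<close>

abbreviation borel_arc_length :: "(real \<times> real) measure" where
  "borel_arc_length \<equiv> distr (restrict_space lborel {0..<2 * pi}) (restrict_space borel (sphere 0 1))
     (\<lambda>t. (cos t, sin t))"

lemma nn_integral_arc_length: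
  assumes "w \<in> borel_measurable borel"
  shows "(\<integral>\<^sup>+ z. w z \<partial>arc_length) = (\<integral>\<^sup>+\<theta>\<in>{0..<2 * pi}. w (cos \<theta>, sin \<theta>) \<partial>lborel)"
proof -
  have "w \<in> borel_measurable (restrict_space borel (sphere 0 1))"
    using assms by (rule measurable_restrict_space1)
  then show ?thesis
    by (simp add: arc_length_def nn_integral_completion nn_integral_distr[OF arc_length_param_measurable]
        nn_integral_restrict_space)
qed

text \<open>
  By polar coordinates the cone over a null set of the circle is a null set of the plane.
\<close>

lemma AE_lborel_direction:
  assumes "AE z in borel_arc_length. P z"
  shows "AE y in lborel. P (y /\<^sub>R norm y)"
proof -
  obtain N where N: "N \<in> sets borel_arc_length" "emeasure borel_arc_length N = 0"
    "{z \<in> space borel_arc_length. \<not> P z} \<subseteq> N"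
    using assms by (auto elim: AE_E)
  have [measurable]: "N \<in> sets borel"
    using N(1) by (auto simp: sets_restrict_space)
  have [measurable]: "N \<in> sets (borel \<Otimes>\<^sub>M borel)"
    unfolding borel_prod by fact
  have "(\<integral>\<^sup>+\<theta>\<in>{0..<2 * pi}. indicator N (cos \<theta>, sin \<theta>) \<partial>lborel) = (\<integral>\<^sup>+ z. indicator N z \<partial>arc_length)"
    by (rule nn_integral_arc_length[symmetric]) measurable
  also have "\<dots> = 0"
    using N by (simp add: arc_length_def nn_integral_completion)
  finally have null: "AE \<theta> in lborel. indicator N (cos \<theta>, sin \<theta>) * indicator {0..<2 * pi} \<theta> = (0 :: ennreal)"
    by (subst (asm) nn_integral_0_iff_AE) measurable
  have "(\<integral>\<^sup>+ y. indicator N (y /\<^sub>R norm y) \<partial>lborel) = (\<integral>\<^sup>+\<theta>\<in>{0..<2 * pi}. (\<integral>\<^sup>+r\<in>{0<..}. ennreal r *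
      indicator N ((r * cos \<theta>, r * sin \<theta>) /\<^sub>R norm (r * cos \<theta>, r * sin \<theta>)) \<partial>lborel) \<partial>lborel)"
    by (rule nn_integral_polar) measurable
  also have "\<dots> = (\<integral>\<^sup>+(\<theta>::real). 0 \<partial>lborel)"
  proof (rule nn_integral_cong_AE)
    show "AE \<theta> in lborel. (\<integral>\<^sup>+r\<in>{0<..}. ennreal r *
      indicator N ((r * cos \<theta>, r * sin \<theta>) /\<^sub>R norm (r * cos \<theta>, r * sin \<theta>)) \<partial>lborel) * indicator {0..<2 * pi} \<theta> = 0"
      using null
    proof eventually_elim
      case (elim \<theta>)
      show ?case
      proof (cases "\<theta> \<in> {0..<2 * pi}")
        case True
        then have "(cos \<theta>, sin \<theta>) \<notin> N" using elim by (auto simp: indicator_def)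
        have "ennreal r * indicator N ((r * cos \<theta>, r * sin \<theta>) /\<^sub>R norm (r * cos \<theta>, r * sin \<theta>))
            * indicator {0<..} r = (0 :: ennreal)" for r
        proof (cases "0 < r")
          case True
          show ?thesis
            unfolding direction_polar[OF True] using \<open>(cos \<theta>, sin \<theta>) \<notin> N\<close> by simp
        qed simp
        then show ?thesis by (simp only: nn_integral_const) simp
      qed simp
    qed
  qed
  finally have "(\<integral>\<^sup>+ y. indicator N (y /\<^sub>R norm y) \<partial>lborel) = 0" by simp
  then have "AE y in lborel. indicator N (y /\<^sub>R norm y) = (0 :: ennreal)"
    by (subst (asm) nn_integral_0_iff_AE) measurable
  moreover have "AE y in lborel. y \<noteq> (0 :: real \<times> real)"
    by (rule AE_lborel_singleton)
  ultimately show ?thesis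
  proof eventually_elim
    case (elim y)
    then have "y /\<^sub>R norm y \<in> space borel_arc_length"
      by (simp add: space_restrict_space)
    moreover have "y /\<^sub>R norm y \<notin> N"
      using elim by (auto simp: indicator_def split: if_splits)
    ultimately show ?case using N(3) by blast
  qed
qed

lemma AE_lborel_reflected_coordinates:
  fixes x :: real
  assumes "AE z in lborel. P z"
  shows "AE y :: real \<times> real in lborel. P (x - fst y)"
    and "AE y :: real \<times> real in lborel. P (x - snd y)"
proof -
  obtain N where N: "N \<in> sets borel" "AE z in lborel. z \<notin> N" "\<And>z. \<not> P z \<Longrightarrow> z \<in> N"
  proof -
    obtain N where "N \<in> null_sets lborel" "{z \<in> space lborel. \<not> P z} \<subseteq> N"
      using assms by (auto elim: AE_E simp: null_sets_def)
    then show ?thesis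
      by (intro that[of N]) (auto intro: AE_not_in)
  qed
  note [measurable] = N(1)
  have "AE z in lborel. x + (- 1) * z \<notin> N"
    using N(2) by (intro AE_borel_affine) auto
  then have N': "AE z in lborel. x - z \<notin> N" by simp
  have "AE y in lborel \<Otimes>\<^sub>M lborel. x - fst (y :: real \<times> real) \<notin> N"
  proof (rule lborel_pair.AE_pair_measure)
    show "{y \<in> space (lborel \<Otimes>\<^sub>M lborel). x - fst (y :: real \<times> real) \<notin> N} \<in> sets (lborel \<Otimes>\<^sub>M lborel)"
      by measurable
    show "AE y\<^sub>1 in lborel. AE y\<^sub>2 in lborel. x - fst (y\<^sub>1, y\<^sub>2 :: real) \<notin> N"
      using N' by eventually_elim simp
  qed
  then show "AE y :: real \<times> real in lborel. P (x - fst y)"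
    unfolding lborel_prod by eventually_elim (use N(3) in blast)
  have "AE y in lborel \<Otimes>\<^sub>M lborel. x - snd (y :: real \<times> real) \<notin> N"
  proof (rule lborel_pair.AE_pair_measure)
    show "{y \<in> space (lborel \<Otimes>\<^sub>M lborel). x - snd (y :: real \<times> real) \<notin> N} \<in> sets (lborel \<Otimes>\<^sub>M lborel)"
      by measurable
    show "AE y\<^sub>1 in lborel. AE y\<^sub>2 in lborel. x - snd (y\<^sub>1 :: real, y\<^sub>2) \<notin> N"
      using N' by simp
  qed
  then show "AE y :: real \<times> real in lborel. P (x - snd y)"
    unfolding lborel_prod by eventually_elim (use N(3) in blast)
qed

text \<open>
  On the circle \<open>\<bar>\<theta> \<bullet> \<xi>\<bar> \<le> 1\<close>, so already the integral for the single direction \<open>\<xi> = (1, 0)\<close>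
  dominates the \<open>L\<^sup>1\<close> norm.
\<close>

lemma nn_integral_arc_length_le_K_norm:
  assumes "0 \<le> a"
  shows "(\<integral>\<^sup>+ \<theta>. ennreal (cmod (\<Omega> \<theta>)) \<partial>arc_length) \<le> K_norm a \<Omega>"
proof -
  have "(\<integral>\<^sup>+ \<theta>. ennreal (cmod (\<Omega> \<theta>)) \<partial>arc_length)
    \<le> (\<integral>\<^sup>+ \<theta>. ennreal (cmod (\<Omega> \<theta>)) / ennreal (\<bar>\<theta> \<bullet> (1, 0)\<bar> powr a) \<partial>arc_length)"
  proof (rule nn_integral_mono)
    fix \<theta> assume "\<theta> \<in> space arc_length"
    then have "\<bar>\<theta> \<bullet> (1, 0)\<bar> \<le> 1"
      using Cauchy_Schwarz_ineq2[of \<theta> "(1, 0)"] by (simp add: space_arc_length norm_Pair)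
    then have "\<bar>\<theta> \<bullet> (1, 0)\<bar> powr a \<le> 1"
      using powr_mono2[of a "\<bar>\<theta> \<bullet> (1, 0)\<bar>" 1] assms by simp
    then show "ennreal (cmod (\<Omega> \<theta>)) \<le> ennreal (cmod (\<Omega> \<theta>)) / ennreal (\<bar>\<theta> \<bullet> (1, 0)\<bar> powr a)"
    proof (cases "\<theta> \<bullet> (1, 0) = 0")
      case False
      then have "cmod (\<Omega> \<theta>) \<le> cmod (\<Omega> \<theta>) / \<bar>\<theta> \<bullet> (1, 0)\<bar> powr a"
        using \<open>\<bar>\<theta> \<bullet> (1, 0)\<bar> powr a \<le> 1\<close> by (simp add: le_divide_eq mult_left_le)
      then show ?thesis
        using False by (subst divide_ennreal) (auto intro: ennreal_leI)
    qed simp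
  qed
  also have "\<dots> \<le> K_norm a \<Omega>"
    unfolding K_norm_def by (rule SUP_upper) (simp add: norm_Pair)
  finally show ?thesis .
qed

lemma Lp_norm_eq_borel:
  assumes "f \<in> borel_measurable lebesgue" and ae: "AE x in lborel. f x = g x"
  shows "Lp_norm q f = ennreal_powr (\<integral>\<^sup>+ x. ennreal_powr (g x) q \<partial>lborel) (1 / q)"
proof -
  have "(\<integral>\<^sup>+ x. ennreal_powr (f x) q \<partial>lborel) = (\<integral>\<^sup>+ x. ennreal_powr (g x) q \<partial>lborel)"
    using ae by (intro nn_integral_cong_AE) auto
  then show ?thesis
    using assms(1) by (simp add: Lp_norm_def nn_integral_completion)
qed

text \<open>
  The equality holds at every point, because for fixed \<open>x\<close> each of the three exceptional null
  sets changes the integrand only on a null set of the plane: a cone, or the product of a null set with a line.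
\<close>

lemma rough_maximal_eq_borel:
  assumes \<Omega>: "AE z in borel_arc_length. ennreal (cmod (\<Omega> z)) = w z"
    and f: "AE x in lborel. ennreal (cmod (f\<^sub>1 x)) = g\<^sub>1 x" "AE x in lborel. ennreal (cmod (f\<^sub>2 x)) = g\<^sub>2 x"
  shows "rough_maximal \<Omega> f\<^sub>1 f\<^sub>2 = borel_rough_maximal w g\<^sub>1 g\<^sub>2"
proof
  fix x
  have ae: "AE y in lborel. ennreal (cmod (\<Omega> (y /\<^sub>R norm y)) * cmod (f\<^sub>1 (x - fst y) * f\<^sub>2 (x - snd y)))
      = w (y /\<^sub>R norm y) * (g\<^sub>1 (x - fst y) * g\<^sub>2 (x - snd y))"
    using AE_lborel_direction[OF \<Omega>] AE_lborel_reflected_coordinates(1)[OF f(1), of x]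
      AE_lborel_reflected_coordinates(2)[OF f(2), of x]
    by eventually_elim (simp add: norm_mult ennreal_mult)
  have "(\<integral>\<^sup>+ y\<in>cball 0 R. ennreal (cmod (\<Omega> (y /\<^sub>R norm y)) * cmod (f\<^sub>1 (x - fst y) * f\<^sub>2 (x - snd y))) \<partial>lebesgue)
    = (\<integral>\<^sup>+y\<in>cball 0 R. w (y /\<^sub>R norm y) * (g\<^sub>1 (x - fst y) * g\<^sub>2 (x - snd y)) \<partial>lborel)" for R
    unfolding nn_integral_completion using ae by (intro nn_integral_cong_AE) auto
  then show "rough_maximal \<Omega> f\<^sub>1 f\<^sub>2 x = borel_rough_maximal w g\<^sub>1 g\<^sub>2 x"
    by (simp add: rough_maximal_def borel_rough_maximal_def)
qed

theorem theorem1p3: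
  fixes p\<^sub>1 p\<^sub>2 p a :: real
  assumes "1 < p\<^sub>1" "1 < p\<^sub>2" "1 < p"
    and "1 / p = 1 / p\<^sub>1 + 1 / p\<^sub>2"
    and "1 / 2 < a" "a < 1"
  shows "\<exists>C::real. C > 0 \<and>
    (\<forall>\<Omega> \<in> borel_measurable arc_length. K_norm a \<Omega> < \<infinity> \<longrightarrow>
      (\<forall>f\<^sub>1 \<in> Lp_space p\<^sub>1. \<forall>f\<^sub>2 \<in> Lp_space p\<^sub>2.
        Lp_norm p (rough_maximal \<Omega> f\<^sub>1 f\<^sub>2)
          \<le> ennreal C * K_norm a \<Omega> * Lp_norm p\<^sub>1 (\<lambda>x. ennreal (cmod (f\<^sub>1 x)))
             * Lp_norm p\<^sub>2 (\<lambda>x. ennreal (cmod (f\<^sub>2 x)))))"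
proof (intro exI[of _ "2 * (p * (10 / (p - 1) * 2 powr (p - 1))) powr (1 / p)"] conjI ballI impI)
  let ?C = "2 * (p * (10 / (p - 1) * 2 powr (p - 1))) powr (1 / p)"
  show "0 < ?C" using \<open>1 < p\<close> by simp
  fix \<Omega> :: "real \<times> real \<Rightarrow> complex" and f\<^sub>1 f\<^sub>2 :: "real \<Rightarrow> complex"
  assume \<Omega> [measurable]: "\<Omega> \<in> borel_measurable arc_length"
    and f: "f\<^sub>1 \<in> Lp_space p\<^sub>1" "f\<^sub>2 \<in> Lp_space p\<^sub>2"
  have f\<^sub>1: "(\<lambda>x. ennreal (cmod (f\<^sub>1 x))) \<in> borel_measurable lebesgue"
    and f\<^sub>2: "(\<lambda>x. ennreal (cmod (f\<^sub>2 x))) \<in> borel_measurable lebesgue"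
    using f by (auto simp: Lp_space_def)
  obtain g\<^sub>1 where g\<^sub>1: "g\<^sub>1 \<in> borel_measurable borel" "AE x in lborel. ennreal (cmod (f\<^sub>1 x)) = g\<^sub>1 x"
    using completion_ex_borel_measurable[OF f\<^sub>1] by auto
  obtain g\<^sub>2 where g\<^sub>2: "g\<^sub>2 \<in> borel_measurable borel" "AE x in lborel. ennreal (cmod (f\<^sub>2 x)) = g\<^sub>2 x"
    using completion_ex_borel_measurable[OF f\<^sub>2] by auto
  have "(\<lambda>z. ennreal (cmod (\<Omega> z))) \<in> borel_measurable (completion borel_arc_length)"
    unfolding arc_length_def[symmetric] by measurable
  from completion_ex_borel_measurable[OF this] obtain w\<^sub>0
    where w\<^sub>0: "w\<^sub>0 \<in> borel_measurable (restrict_space borel (sphere 0 1))"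
      "AE z in borel_arc_length. ennreal (cmod (\<Omega> z)) = w\<^sub>0 z" by auto
  \<comment> \<open>Extended by \<open>0\<close> from the circle to the plane, so that \<open>w (y /\<^sub>R norm y)\<close> is Borel in \<open>y\<close>.\<close>
  define w where "w z = w\<^sub>0 z * indicator (sphere 0 1) z" for z
  have w: "w \<in> borel_measurable borel"
    unfolding w_def using w\<^sub>0(1) by (subst (asm) borel_measurable_restrict_space_iff_ennreal) auto
  have \<Omega>w: "AE z in borel_arc_length. ennreal (cmod (\<Omega> z)) = w z"
    using w\<^sub>0(2) AE_space by eventually_elim (simp add: w_def space_restrict_space)
  have W: "(\<integral>\<^sup>+\<theta>\<in>{0..<2 * pi}. w (cos \<theta>, sin \<theta>) \<partial>lborel) \<le> K_norm a \<Omega>"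
  proof -
    have "(\<integral>\<^sup>+\<theta>\<in>{0..<2 * pi}. w (cos \<theta>, sin \<theta>) \<partial>lborel) = (\<integral>\<^sup>+ z. w z \<partial>borel_arc_length)"
      using nn_integral_arc_length[OF w] by (simp add: arc_length_def nn_integral_completion)
    also have "\<dots> = (\<integral>\<^sup>+ z. ennreal (cmod (\<Omega> z)) \<partial>borel_arc_length)"
      using \<Omega>w by (intro nn_integral_cong_AE) auto
    also have "\<dots> = (\<integral>\<^sup>+ z. ennreal (cmod (\<Omega> z)) \<partial>arc_length)"
      by (simp add: arc_length_def nn_integral_completion)
    also have "\<dots> \<le> K_norm a \<Omega>"
      using \<open>1 / 2 < a\<close> by (intro nn_integral_arc_length_le_K_norm) simp
    finally show ?thesis .
  qed
  have M: "rough_maximal \<Omega> f\<^sub>1 f\<^sub>2 = borel_rough_maximal w g\<^sub>1 g\<^sub>2"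
    by (rule rough_maximal_eq_borel[OF \<Omega>w g\<^sub>1(2) g\<^sub>2(2)])
  have "Lp_norm p (rough_maximal \<Omega> f\<^sub>1 f\<^sub>2)
    = ennreal_powr (\<integral>\<^sup>+ x. ennreal_powr (borel_rough_maximal w g\<^sub>1 g\<^sub>2 x) p \<partial>lborel) (1 / p)"
    unfolding M using borel_measurable_borel_rough_maximal[OF w g\<^sub>1(1) g\<^sub>2(1)]
    by (intro Lp_norm_eq_borel) (auto intro: measurable_completion)
  also have "\<dots> \<le> ennreal ?C * (\<integral>\<^sup>+\<theta>\<in>{0..<2 * pi}. w (cos \<theta>, sin \<theta>) \<partial>lborel)
       * ennreal_powr (\<integral>\<^sup>+ x. ennreal_powr (g\<^sub>1 x) p\<^sub>1 \<partial>lborel) (1 / p\<^sub>1)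
       * ennreal_powr (\<integral>\<^sup>+ x. ennreal_powr (g\<^sub>2 x) p\<^sub>2 \<partial>lborel) (1 / p\<^sub>2)"
    by (rule borel_rough_maximal_Lp[OF w g\<^sub>1(1) g\<^sub>2(1) assms(1-4)])
  also have "\<dots> \<le> ennreal ?C * K_norm a \<Omega>
       * ennreal_powr (\<integral>\<^sup>+ x. ennreal_powr (g\<^sub>1 x) p\<^sub>1 \<partial>lborel) (1 / p\<^sub>1)
       * ennreal_powr (\<integral>\<^sup>+ x. ennreal_powr (g\<^sub>2 x) p\<^sub>2 \<partial>lborel) (1 / p\<^sub>2)"
    by (intro mult_right_mono mult_left_mono W) auto
  also have "\<dots> = ennreal ?C * K_norm a \<Omega> * Lp_norm p\<^sub>1 (\<lambda>x. ennreal (cmod (f\<^sub>1 x)))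
       * Lp_norm p\<^sub>2 (\<lambda>x. ennreal (cmod (f\<^sub>2 x)))"
    by (simp add: Lp_norm_eq_borel[OF f\<^sub>1 g\<^sub>1(2)] Lp_norm_eq_borel[OF f\<^sub>2 g\<^sub>2(2)])
  finally show "Lp_norm p (rough_maximal \<Omega> f\<^sub>1 f\<^sub>2) \<le> ennreal ?C * K_norm a \<Omega>
       * Lp_norm p\<^sub>1 (\<lambda>x. ennreal (cmod (f\<^sub>1 x))) * Lp_norm p\<^sub>2 (\<lambda>x. ennreal (cmod (f\<^sub>2 x)))" .
qed

end
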